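(* Let $n\ge2$ be an integer, let $0<r<\pi/4-\varepsilon$, and let $K:\mathbb S^{k}\times\mathbb S^{k}\to\mathbb R$ have the form $K(x,y)=g(d(x,y)^2)$ for all $x,y\in\mathbb S^k$, where $g:[0,\infty)\to\mathbb R$ is differentiable with locally Lipschitz continuous derivative and $g'\ge0$. Assume that $g'$ has continuous derivative on $[0,4r^2]$ and satisfies $g'(s)\ge C s^\alpha$ for all $s\in[0,4r^2]$, for some $C>0$ and $\alpha\ge0$. Let $(x_i^0)_{i=1}^n\subset\overline D_r$. Then the unique global solution $(x_i)_{i=1}^n$ in $\overline D_r$ of $$x_i'(t)=-\frac1n\sum_{j=1}^n\nabla_{\mathbb S^k}K_{x_j(t)}(x_i(t)),\qquad x_i(0)=x_i^0,\qquad i=1,\dots,n,\ t\in[0,\infty),$$ is such that $d(x_i(t),x_j(t))\to0$ as $t\to\infty$ for every $i,j\in\{1,\dots,n\}$.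
   Context: $\mathbb S^k\subset\mathbb R^{k+1}$ is the $k$-dimensional unit sphere with the metric induced from $\mathbb R^{k+1}$; its intrinsic distance is $d(x,y)=\arccos(x\cdot y)\in[0,\pi]$. Points and tangent vectors are regarded as vectors of $\mathbb R^{k+1}$. $N=(0,\dots,0,1)$ is the North pole, $\varepsilon\in(0,\pi/2)$ is fixed (here necessarily $\varepsilon<\pi/4$), and $\overline D_r=\{x\in\mathbb S^k: d(x,N)\le r\}$. $K_y(x)=K(x,y)$ and $\nabla_{\mathbb S^k}$ is the manifold gradient in $x$; for $x,y\in\mathbb S^k$ with $d(x,y)<\pi$, $\nabla_{\mathbb S^k}K_y(x)=-2g'(d(x,y)^2)\log_xy$, with $\log_x y=\frac{\theta}{\sin\theta}(y-\cos\theta\,x)$, $\theta=d(x,y)$ (and $\log_xx=0$). For initial points $(x_i^0)_{i=1}^n\subset\overline D_r$ and $g'\ge0$, the system $x_i'(t)=-\frac1n\sum_{j=1}^n\nabla_{\mathbb S^k}K_{x_j(t)}(x_i(t))$, $x_i(0)=x_i^0$, $i=1,\dots,n$, has a unique global solution, which satisfies $x_i(t)\in\overline D_r$ for all $i$ and $t\ge0$. The convention $s^0=1$ for all $s\ge0$ is used. *)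

theory Defs
  imports "HOL-Analysis.Analysis"
begin

text \<open>
  The ambient space R^(k+1) is rendered as R^k times R, so that k is the cardinality of the
  index type (hence k at least 1) and the last coordinate is the second component. The product
  carries the Euclidean inner product and norm, and the unit sphere is \<^term>\<open>sphere 0 1\<close>.
\<close>

type_synonym 'k ambient = "(real ^ 'k) \<times> real"

definition north_pole :: "'k::finite ambient" where
  "north_pole = (0, 1)"

definition sphere_dist :: "'k::finite ambient \<Rightarrow> 'k ambient \<Rightarrow> real" where
  "sphere_dist x y = arccos (x \<bullet> y)"

definition closed_cap :: "real \<Rightarrow> 'k::finite ambient set" where
  "closed_cap r = {x \<in> sphere 0 1. sphere_dist x north_pole \<le> r}"

text \<open>
  The Riemannian gradient of f at a point x of the sphere is the tangent vector v at x
  representing the differential of f along the sphere. The filter \<open>at x within sphere 0 1\<close> makes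
  this depend only on the restriction of f to the sphere; a derivative within the sphere is
  determined on tangent vectors only, and the tangency of v makes it unique (see below).
\<close>

definition has_sphere_gradient ::
    "('k::finite ambient \<Rightarrow> real) \<Rightarrow> 'k ambient \<Rightarrow> 'k ambient \<Rightarrow> bool" where
  "has_sphere_gradient f v x \<longleftrightarrow>
     v \<bullet> x = 0 \<and> (f has_derivative (\<lambda>h. v \<bullet> h)) (at x within sphere 0 1)"

definition sphere_gradient :: "('k::finite ambient \<Rightarrow> real) \<Rightarrow> 'k ambient \<Rightarrow> 'k ambient" where
  "sphere_gradient f x = (THE v. has_sphere_gradient f v x)"

lemma has_sphere_gradient_unique:
  fixes x :: "'k::finite ambient"
  assumes x: "x \<in> sphere 0 1"
    and v: "has_sphere_gradient f v x" and w: "has_sphere_gradient f w x"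
  shows "v = w"
proof (rule ccontr)
  assume "v \<noteq> w"
  define e where "e = (1 / norm (v - w)) *\<^sub>R (v - w)"
  define c where "c s = cos s *\<^sub>R x + sin s *\<^sub>R e" for s :: real
  have ne: "norm e = 1" using \<open>v \<noteq> w\<close> by (simp add: e_def)
  have ex: "e \<bullet> x = 0"
    using v w by (simp add: e_def has_sphere_gradient_def inner_diff_left)
  have ee: "e \<bullet> e = 1" and xx: "x \<bullet> x = 1"
    using ne x by (simp_all add: dot_square_norm)
  have "c s \<bullet> c s = 1" for s
  proof -
    have "c s \<bullet> c s = (cos s)\<^sup>2 + (sin s)\<^sup>2"
      using ee xx ex
      by (simp add: c_def inner_add_left inner_add_right inner_commute power2_eq_square)
    then show ?thesis by simp
  qed
  then have c_sphere: "range c \<subseteq> sphere 0 1" by (auto simp: norm_eq_1)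
  have c': "(c has_derivative (\<lambda>s. s *\<^sub>R e)) (at 0)"
    unfolding c_def by (auto intro!: derivative_eq_intros)
  have c0: "c 0 = x" by (simp add: c_def)
  have comp: "((\<lambda>s. f (c s)) has_derivative (\<lambda>s. u \<bullet> (s *\<^sub>R e))) (at 0)"
    if "has_sphere_gradient f u x" for u
  proof -
    have "(f has_derivative (\<lambda>h. u \<bullet> h)) (at (c 0) within range c)"
      using that c_sphere c0
      by (auto simp: has_sphere_gradient_def intro: has_derivative_subset)
    then show ?thesis using has_derivative_in_compose[OF c'] by blast
  qed
  have "(\<lambda>s. v \<bullet> (s *\<^sub>R e)) = (\<lambda>s. w \<bullet> (s *\<^sub>R e))"
    using has_derivative_unique[OF comp[OF v] comp[OF w]] .
  from fun_cong[OF this, of 1] have "(v - w) \<bullet> e = 0" by (simp add: inner_diff_left)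
  then show False using \<open>v \<noteq> w\<close> by (simp add: e_def)
qed

lemma sphere_gradient_eq:
  assumes "x \<in> sphere 0 1" "has_sphere_gradient f v x"
  shows "sphere_gradient f x = v"
  unfolding sphere_gradient_def
  using assms has_sphere_gradient_unique by blast

text \<open>
  Real powers of nonnegative numbers with the convention that the zeroth power is 1, also at the
  base 0 (whereas \<^term>\<open>0 powr 0\<close> is 0).
\<close>

definition rpow :: "real \<Rightarrow> real \<Rightarrow> real" where
  "rpow s a = (if a = 0 then 1 else s powr a)"

text \<open>
  Global solutions on the sphere, with time in \<open>{0..}\<close> and particles indexed by \<open>{1..n}\<close>; the
  values \<open>x i t\<close> for other indices or negative times are irrelevant.
\<close>

definition gradient_flow_solution ::
    "nat \<Rightarrow> ('k::finite ambient \<Rightarrow> 'k ambient \<Rightarrow> real) \<Rightarrow> (nat \<Rightarrow> 'k ambient)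
      \<Rightarrow> (nat \<Rightarrow> real \<Rightarrow> 'k ambient) \<Rightarrow> bool" where
  "gradient_flow_solution n K x0 x \<longleftrightarrow>
     (\<forall>i\<in>{1..n}. x i 0 = x0 i \<and>
        (\<forall>t\<ge>0. x i t \<in> sphere 0 1 \<and>
           (x i has_vector_derivative
              - (1 / real n) *\<^sub>R (\<Sum>j=1..n. sphere_gradient (\<lambda>z. K z (x j t)) (x i t)))
             (at t within {0..})))"

end

theory Submission
  imports Defs "HOL-Probability.Discrete_Topology"
begin

text \<open>
  Writing \<open>c\<^sub>i\<^sub>j = x\<^sub>i \<bullet> x\<^sub>j\<close> and \<open>\<phi>(cos \<theta>) = 2 g'(\<theta>\<^sup>2) \<theta> / sin \<theta>\<close>, the system reads
  \<open>x\<^sub>i' = (1/n) \<Sum>\<^sub>j \<phi>(c\<^sub>i\<^sub>j) (x\<^sub>j - c\<^sub>i\<^sub>j x\<^sub>i)\<close> as long as no two particles are antipodal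
  (\<open>sphere_gradient_radial_kernel\<close>). Everything rests on \<open>\<phi> \<ge> 0\<close>: particles only attract.

  Existence. The function \<open>\<phi>\<close> is Lipschitz on \<open>[0, 1]\<close>, that is, up to angle \<open>\<pi>/2\<close>
  (\<open>attraction_lipschitz\<close>). Clamping its argument to \<open>[0, 1]\<close> and projecting all points onto the
  closed unit ball gives a bounded, globally Lipschitz vector field on the whole ambient space, whose
  flow exists for all times by a contraction argument
  (\<open>lipschitz_system_has_global_solution\<close>). The modification is
  never felt. By Gronwall's inequality the flow preserves the unit sphere (\<open>solution_norm_eq_1\<close>), and it preserves the cap
  because the lowest particle can only be pulled upwards (\<open>solution_height_bound\<close>). Inside the
  cap of radius \<open>r < \<pi>/4\<close> all \<open>c\<^sub>i\<^sub>j\<close> are at least \<open>\<kappa> = cos 2r > 0\<close>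
  (\<open>inner_ge_cos_double\<close>).

  Uniqueness. Any other solution obeys the modified equation until some \<open>c\<^sub>i\<^sub>j\<close> first becomes
  nonpositive. Up to and including that time it agrees with the solution constructed before
  (\<open>solutions_agree\<close>), for which \<open>c\<^sub>i\<^sub>j \<ge> \<kappa>\<close>, so that such a time does not exist.

  Consensus. The Lyapunov function is \<open>D = \<Sum>\<^sub>i\<^sub>j (1 - c\<^sub>i\<^sub>j) = n\<^sup>2 - |\<Sum>\<^sub>i x\<^sub>i|\<^sup>2\<close>. Differentiating
  and symmetrizing in \<open>i\<close> and \<open>j\<close> gives
  \<open>D' = - (1/n) \<Sum>\<^sub>i\<^sub>j\<^sub>k \<phi>(c\<^sub>i\<^sub>j) (1 - c\<^sub>i\<^sub>j) (c\<^sub>i\<^sub>k + c\<^sub>j\<^sub>k) \<le> - 2 \<kappa> \<Sum>\<^sub>i\<^sub>j \<phi>(c\<^sub>i\<^sub>j) (1 - c\<^sub>i\<^sub>j)\<close>.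
  The lower bound on \<open>g'\<close> keeps \<open>\<phi>\<close> away from zero as long as the angle stays away from zero
  (\<open>attraction_bounded_below\<close>), so while \<open>D\<close> is at least some positive number it decreases at a
  rate bounded away from zero. Since \<open>D \<ge> 0\<close>, it must tend to zero (\<open>solution_consensus\<close>).
\<close>

section \<open>Global solutions of bounded Lipschitz systems\<close>

text \<open>
  The differential inequality makes \<open>exp (- M t) w t\<close> nonincreasing. It is used for nonnegative \<open>w\<close>
  starting at zero, which therefore vanish. The derivative is only required inside the interval, so
  that a solution can be followed up to a first exit time.
\<close>

lemma gronwall_nonpos:
  fixes w :: "real \<Rightarrow> real"
  assumes "0 \<le> T" and cont: "continuous_on {0..T} w"
    and der: "\<And>t. 0 < t \<Longrightarrow> t < T \<Longrightarrow> (w has_real_derivative w' t) (at t)"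
    and le: "\<And>t. 0 < t \<Longrightarrow> t < T \<Longrightarrow> w' t \<le> M * w t"
    and "w 0 \<le> 0"
  shows "w T \<le> 0"
proof -
  have "exp (- M * T) * w T \<le> exp (- M * 0) * w 0"
  proof (rule DERIV_nonpos_imp_decreasing_open[OF \<open>0 \<le> T\<close>])
    fix t assume t: "0 < t" "t < T"
    have "((\<lambda>t. exp (- M * t) * w t) has_real_derivative
        exp (- M * t) * (w' t - M * w t)) (at t)"
      by (auto intro!: derivative_eq_intros der[OF t] simp: algebra_simps)
    moreover have "exp (- M * t) * (w' t - M * w t) \<le> 0"
      using le[OF t] by (simp add: mult_nonneg_nonpos)
    ultimately show "\<exists>y. ((\<lambda>t. exp (- M * t) * w t) has_real_derivative y) (at t) \<and> y \<le> 0"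
      by blast
  qed (intro continuous_intros cont)
  also have "\<dots> \<le> 0" using \<open>w 0 \<le> 0\<close> by simp
  finally show ?thesis by (simp add: mult_le_0_iff)
qed

lemma integral_has_vector_derivative_atLeast:
  fixes f :: "real \<Rightarrow> 'a::banach"
  assumes "continuous_on {a..} f" "a \<le> t"
  shows "((\<lambda>u. integral {a..u} f) has_vector_derivative f t) (at t within {a..})"
proof -
  have "((\<lambda>u. integral {a..u} f) has_vector_derivative f t) (at t within {a..t + 1})"
    using assms by (intro integral_has_vector_derivative) (auto intro: continuous_on_subset)
  moreover have "at t within {a..t + 1} = at t within {a..}"
    by (rule at_within_nhd[of _ "{..<t + 1}"]) auto
  ultimately show ?thesis by simp
qed

text \<open>
  The integral equation is solved on the whole half line at once. Writing
  \<open>x\<^sub>i(t) = x\<^sub>i(0) + exp (\<mu> t) y\<^sub>i(t)\<close>, the unknown \<open>y\<close> is bounded and continuous, and for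
  \<open>\<mu>\<close> large compared with the Lipschitz constant the integral operator contracts the
  supremum norm (Bielecki's weighted norm). The family \<open>y\<close> is a single bounded continuous function
  because the index set carries the discrete metric.
\<close>

lemma lipschitz_system_has_global_solution:
  fixes F :: "('i \<Rightarrow> 'a::banach) \<Rightarrow> 'i \<Rightarrow> 'a"
  assumes lip: "\<And>u v i. norm (F u i - F v i) \<le> L * (\<Sum>j\<in>I. norm (u j - v j))"
    and bound: "\<And>u i. norm (F u i) \<le> B"
  shows "\<exists>x. \<forall>i. x i 0 = x0 i \<and>
    (\<forall>t\<ge>0. (x i has_vector_derivative F (\<lambda>j. x j t) i) (at t within {0..}))"
proof -
  define \<mu> where "\<mu> = 2 * \<bar>L\<bar> * real (card I) + 1"
  have \<mu>: "\<mu> > 0" "\<mu> \<ge> 2 * (\<bar>L\<bar> * real (card I))"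
    by (auto simp: \<mu>_def intro: add_nonneg_pos)
  have B: "B \<ge> 0" using norm_ge_zero[of "F undefined undefined"] bound[of undefined undefined] by linarith
  define G where "G y i s = F (\<lambda>j. x0 j + exp (\<mu> * s) *\<^sub>R apply_bcontfun y (discrete j, s)) i"
    for y :: "('i discrete \<times> real) \<Rightarrow>\<^sub>C 'a" and i and s :: real
  \<comment> \<open>Times below zero are mapped to zero, since bounded continuous functions live on the whole line.\<close>
  define S where "S y = (\<lambda>(i, t). exp (- \<mu> * max 0 t) *\<^sub>R integral {0..max 0 t} (G y (of_discrete i)))" for y
  have y_cont: "continuous_on UNIV (\<lambda>s. apply_bcontfun y (discrete j, s))" for y :: "('i discrete \<times> real) \<Rightarrow>\<^sub>C 'a" and j
    by (rule continuous_on_compose2[OF continuous_on_apply_bcontfun[of UNIV y]])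
       (auto intro!: continuous_intros)
  have F_cont: "continuous_on A (\<lambda>s. F (\<lambda>j. f j s) i)"
    if f: "\<And>j. continuous_on A (f j)" for f i and A :: "real set"
    unfolding continuous_on_def
  proof
    fix s assume s: "s \<in> A"
    show "((\<lambda>s. F (\<lambda>j. f j s) i) \<longlongrightarrow> F (\<lambda>j. f j s) i) (at s within A)"
    proof (rule Lim_transform_bound[OF _ _, THEN Lim_null[THEN iffD2]])
      show "\<forall>\<^sub>F u in at s within A. norm (F (\<lambda>j. f j u) i - F (\<lambda>j. f j s) i)
          \<le> norm (L * (\<Sum>j\<in>I. norm (f j u - f j s)))"
        by (auto intro!: always_eventually order_trans[OF lip abs_ge_self])
      have "((\<lambda>u. L * (\<Sum>j\<in>I. norm (f j u - f j s))) \<longlongrightarrow> L * (\<Sum>j\<in>I. norm (f j s - f j s))) (at s within A)"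
        using f s by (intro tendsto_intros) (auto simp: continuous_on_def)
      then show "((\<lambda>u. L * (\<Sum>j\<in>I. norm (f j u - f j s))) \<longlongrightarrow> 0) (at s within A)" by simp
    qed
  qed
  have G_cont: "continuous_on A (G y i)" for A y i
    unfolding G_def by (intro F_cont continuous_intros continuous_on_subset[OF y_cont]) auto
  have G_int: "G y i integrable_on {0..t}" for y i t
    by (intro integrable_continuous_interval G_cont)
  have int_cont: "continuous_on {0..} (\<lambda>t. integral {0..t} (G y i))" for y i
    using integral_has_vector_derivative_atLeast[OF G_cont]
    by (meson atLeast_iff continuous_on_eq_continuous_within has_vector_derivative_continuous)
  have S_bcontfun: "S y \<in> bcontfun" for y
  proof (rule bcontfun_normI)
    have sl: "continuous_on UNIV (\<lambda>t. S y (i, t))" for i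
      unfolding S_def prod.case
      by (intro continuous_intros continuous_on_compose2[OF int_cont]) auto
    show "continuous_on UNIV (S y)"
      unfolding continuous_on_def
    proof (safe)
      fix i :: "'i discrete" and t :: real
      have "((\<lambda>p. S y (i, snd p)) \<longlongrightarrow> S y (i, t)) (at (i, t))"
        using sl[of i]
        by (intro isCont_tendsto_compose[where g="\<lambda>t. S y (i, t)"])
           (auto simp: continuous_on_eq_continuous_at intro!: tendsto_eq_intros)
      moreover have "\<forall>\<^sub>F p in at (i, t). S y (i, snd p) = S y p"
        unfolding eventually_at_topological
        by (rule exI[of _ "{i} \<times> UNIV"]) (auto intro!: open_Times simp: Discrete_Topology.open_discrete)
      ultimately show "(S y \<longlongrightarrow> S y (i, t)) (at (i, t))"
        by (rule Lim_transform_eventually)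
    qed
    show "norm (S y p) \<le> B / \<mu>" for p
    proof -
      obtain i t where p: "p = (discrete i, t)" by (metis of_discrete_inverse surj_pair)
      define u where "u = max 0 t"
      have u: "u \<ge> 0" by (simp add: u_def)
      have "norm (integral {0..u} (G y i)) \<le> B * (u - 0)"
        by (rule integral_bound) (use u G_cont in \<open>auto simp: G_def bound\<close>)
      moreover have "\<mu> * u \<le> exp (\<mu> * u)"
        using exp_ge_add_one_self[of "\<mu> * u"] by linarith
      then have "u \<le> exp (\<mu> * u) / \<mu>" using \<mu> by (simp add: field_simps)
      ultimately have "norm (integral {0..u} (G y i)) \<le> B * (exp (\<mu> * u) / \<mu>)"
        using B mult_left_mono by fastforce
      then have "exp (- \<mu> * u) * norm (integral {0..u} (G y i))
          \<le> exp (- \<mu> * u) * (B * (exp (\<mu> * u) / \<mu>))"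
        by (intro mult_left_mono) auto
      also have "\<dots> = B / \<mu>" by (simp add: exp_minus field_simps)
      finally show ?thesis by (simp add: p S_def u_def discrete_inverse)
    qed
  qed
  define T where "T y = Bcontfun (S y)" for y
  have T: "apply_bcontfun (T y) = S y" for y
    using S_bcontfun by (simp add: T_def Bcontfun_inverse)
  have contr: "dist (T y) (T z) \<le> (1 / 2) * dist y z" for y z
  proof (rule dist_bound)
    fix p :: "'i discrete \<times> real"
    obtain i t where p: "p = (discrete i, t)" by (metis of_discrete_inverse surj_pair)
    define u where "u = max 0 t"
    have u: "u \<ge> 0" by (simp add: u_def)
    define K where "K = \<bar>L\<bar> * real (card I) * dist y z"
    have G_diff: "norm (G y i s - G z i s) \<le> K * exp (\<mu> * s)" for s
    proof -
      have "norm (G y i s - G z i s)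
          \<le> L * (\<Sum>j\<in>I. norm (exp (\<mu> * s) *\<^sub>R (apply_bcontfun y (discrete j, s) - apply_bcontfun z (discrete j, s))))"
        unfolding G_def using lip by (rule order_trans) (simp add: algebra_simps)
      also have "\<dots> \<le> \<bar>L\<bar> * (\<Sum>j\<in>I. exp (\<mu> * s) * dist y z)"
        by (intro mult_mono sum_mono)
           (auto simp: dist_norm[symmetric] intro: dist_bounded sum_nonneg)
      finally show ?thesis by (simp add: K_def algebra_simps)
    qed
    have "((\<lambda>s. K * exp (\<mu> * s)) has_integral K * exp (\<mu> * u) / \<mu> - K * exp (\<mu> * 0) / \<mu>) {0..u}"
      using u \<mu> by (intro fundamental_theorem_of_calculus)
        (auto intro!: derivative_eq_intros simp: has_real_derivative_iff_has_vector_derivative[symmetric])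
    note I = this[THEN integral_unique] this[THEN has_integral_integrable]
    have "norm (integral {0..u} (\<lambda>s. G y i s - G z i s)) \<le> integral {0..u} (\<lambda>s. K * exp (\<mu> * s))"
      by (rule integral_norm_bound_integral) (use G_diff I(2) in \<open>auto intro: integrable_diff G_int\<close>)
    also have "\<dots> \<le> K * exp (\<mu> * u) / \<mu>"
      using I(1) \<mu> by (simp add: K_def)
    finally have "exp (- \<mu> * u) * norm (integral {0..u} (\<lambda>s. G y i s - G z i s))
        \<le> exp (- \<mu> * u) * (K * exp (\<mu> * u) / \<mu>)"
      by (intro mult_left_mono) auto
    also have "\<dots> = K / \<mu>" by (simp add: exp_minus field_simps)
    also have "\<dots> \<le> (1 / 2) * dist y z"
      using \<mu> mult_right_mono[OF \<mu>(2), of "dist y z"] by (simp add: K_def field_simps)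
    finally have "norm (exp (- \<mu> * u) *\<^sub>R (integral {0..u} (G y i) - integral {0..u} (G z i))) \<le> (1 / 2) * dist y z"
      by (simp add: integral_diff[OF G_int G_int])
    then show "dist (T y p) (T z p) \<le> (1 / 2) * dist y z"
      by (simp add: T p S_def discrete_inverse u_def[symmetric] dist_norm scaleR_diff_right)
  qed
  obtain y where y: "T y = y"
    using banach_fix_type[of "1/2" T] contr by auto
  define x where "x i t = x0 i + integral {0..t} (G y i)" for i t
  have x: "x i t = x0 i + exp (\<mu> * t) *\<^sub>R apply_bcontfun y (discrete i, t)" if "t \<ge> 0" for i t
  proof -
    have "apply_bcontfun y (discrete i, t) = S y (discrete i, t)" using T[of y] y by simp
    then show ?thesis using that by (simp add: x_def S_def discrete_inverse exp_minus)
  qed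
  show ?thesis
  proof (intro exI allI conjI impI)
    show "x i 0 = x0 i" for i by (simp add: x_def)
    show "(x i has_vector_derivative F (\<lambda>j. x j t) i) (at t within {0..})" if "t \<ge> 0" for i t
    proof -
      have "(x i has_vector_derivative 0 + G y i t) (at t within {0..})"
        unfolding x_def using that G_cont
        by (intro has_vector_derivative_add integral_has_vector_derivative_atLeast) auto
      then show ?thesis using x[OF that] by (simp add: G_def)
    qed
  qed
qed

section \<open>The gradient of a radial kernel on the sphere\<close>

text \<open>
  This is \<open>\<theta> / sin \<theta>\<close> as a function of \<open>cos \<theta>\<close>, continuously extended to the angle zero. It
  is unbounded near \<open>-1\<close>, the cosine of antipodal points.
\<close>

definition arc_ratio :: "real \<Rightarrow> real" where
  "arc_ratio c = (if c = 1 then 1 else arccos c / sqrt (1 - c\<^sup>2))"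

lemma one_minus_square_pos: "-1 < c \<Longrightarrow> c < 1 \<Longrightarrow> 0 < 1 - c\<^sup>2" for c :: real
  by (simp add: abs_square_less_1)

lemma arc_ratio_ge_1:
  assumes "-1 < c" "c \<le> 1"
  shows "1 \<le> arc_ratio c"
proof (cases "c = 1")
  case False
  then have "0 < sqrt (1 - c\<^sup>2)" using assms one_minus_square_pos[of c] by simp
  moreover have "sqrt (1 - c\<^sup>2) = sin (arccos c)" using assms by (simp add: sin_arccos)
  moreover have "sin (arccos c) \<le> arccos c" using assms by (intro sin_x_le_x arccos_lbound) auto
  ultimately show ?thesis using False by (simp add: arc_ratio_def)
qed (simp add: arc_ratio_def)

text \<open>
  The derivative of \<open>sin x - x cos x\<close> is \<open>x sin x \<ge> 0\<close>.
\<close>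

lemma x_cos_le_sin:
  assumes "0 \<le> x" "x \<le> pi"
  shows "x * cos x \<le> sin x"
proof -
  have "sin 0 - 0 * cos 0 \<le> sin x - x * cos x"
  proof (rule DERIV_nonneg_imp_nondecreasing[OF \<open>0 \<le> x\<close>])
    fix u assume u: "0 \<le> u" "u \<le> x"
    have "((\<lambda>u. sin u - u * cos u) has_real_derivative u * sin u) (at u)"
      by (auto intro!: derivative_eq_intros)
    moreover have "0 \<le> u * sin u" using u assms by (intro mult_nonneg_nonneg sin_ge_zero) auto
    ultimately show "\<exists>y. ((\<lambda>u. sin u - u * cos u) has_real_derivative y) (at u) \<and> 0 \<le> y" by blast
  qed
  then show ?thesis by simp
qed

lemma mult_arc_ratio_le_1:
  assumes "-1 < c" "c \<le> 1"
  shows "c * arc_ratio c \<le> 1"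
proof (cases "c = 1")
  case False
  then have "0 < sqrt (1 - c\<^sup>2)" using assms one_minus_square_pos[of c] by simp
  moreover have "arccos c * cos (arccos c) \<le> sin (arccos c)"
    using assms by (intro x_cos_le_sin arccos_lbound arccos_ubound) auto
  ultimately show ?thesis using False assms by (simp add: arc_ratio_def sin_arccos mult.commute)
qed (simp add: arc_ratio_def)

lemma arccos_square_eq:
  assumes "-1 < c" "c \<le> 1"
  shows "(arccos c)\<^sup>2 = (arc_ratio c)\<^sup>2 * (1 - c\<^sup>2)"
proof (cases "c = 1")
  case False
  then show ?thesis using assms one_minus_square_pos[of c]
    by (simp add: arc_ratio_def power_divide)
qed simp

text \<open>
  The derivative is expressed through \<open>arc_ratio\<close> itself, so that the two elementary bounds
  \<open>arc_ratio_ge_1\<close> and \<open>mult_arc_ratio_le_1\<close> control it up to the endpoint \<open>1\<close>.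
\<close>

lemma DERIV_arc_ratio:
  assumes "-1 < c" "c < 1"
  shows "(arc_ratio has_real_derivative (c * arc_ratio c - 1) / (1 - c\<^sup>2)) (at c)"
proof -
  have pos: "0 < 1 - c\<^sup>2" using assms by (rule one_minus_square_pos)
  have "((\<lambda>c. arccos c / sqrt (1 - c\<^sup>2)) has_real_derivative
      (c * (arccos c / sqrt (1 - c\<^sup>2)) - 1) / (1 - c\<^sup>2)) (at c)"
    using assms pos
    by (auto intro!: derivative_eq_intros simp: divide_simps power2_eq_square)
  then show ?thesis
    using assms pos
    by (subst DERIV_cong_ev[OF refl _ refl, where g = "\<lambda>c. arccos c / sqrt (1 - c\<^sup>2)"])
      (auto simp: arc_ratio_def eventually_nhds intro!: exI[of _ "{..<1}"])
qed

lemma arc_ratio_tendsto_1: "(arc_ratio \<longlongrightarrow> 1) (at 1 within {-1..1})"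
proof (rule tendsto_sandwich[where f = "\<lambda>_. 1" and h = "\<lambda>c. 1 / c"])
  have ev: "\<forall>\<^sub>F c in at 1 within {-1..1}. 0 < c \<and> c \<le> (1::real)"
    unfolding eventually_at_topological by (rule exI[of _ "{0<..}"]) auto
  show "\<forall>\<^sub>F c in at 1 within {-1..1}. 1 \<le> arc_ratio c"
    using ev by eventually_elim (auto intro: arc_ratio_ge_1)
  show "\<forall>\<^sub>F c in at 1 within {-1..1}. arc_ratio c \<le> 1 / c"
    using ev by eventually_elim (use mult_arc_ratio_le_1 in \<open>simp add: field_simps\<close>)
  show "((\<lambda>c. 1 / c) \<longlongrightarrow> (1::real)) (at 1 within {-1..1})"
    by (auto intro!: tendsto_eq_intros)
qed auto

lemma continuous_on_arc_ratio: "continuous_on {-1<..1} arc_ratio"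
  unfolding continuous_on_def
proof
  fix c :: real assume c: "c \<in> {-1<..1}"
  show "(arc_ratio \<longlongrightarrow> arc_ratio c) (at c within {-1<..1})"
  proof (cases "c = 1")
    case True
    then show ?thesis
      using tendsto_within_subset[OF arc_ratio_tendsto_1, of "{-1<..1}"]
      by (simp add: arc_ratio_def[of 1] subset_eq)
  next
    case False
    then show ?thesis
      using c DERIV_isCont[OF DERIV_arc_ratio, of c]
      by (auto simp: continuous_at intro: tendsto_within_subset)
  qed
qed

text \<open>
  The derivative \<open>(c \<psi> - 1) / (1 - c\<^sup>2)\<close>, with \<open>\<psi> \<ge> 1\<close> for the function itself, lies between
  \<open>-1\<close> and \<open>0\<close>, because \<open>c\<^sup>2 \<le> c \<le> c \<psi> \<le> 1\<close>.
\<close>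

lemma arc_ratio_lipschitz: "1-lipschitz_on {0..1} arc_ratio"
proof (rule lipschitz_onI)
  have *: "\<bar>arc_ratio b - arc_ratio a\<bar> \<le> b - a" if ab: "0 \<le> a" "a < b" "b \<le> 1" for a b
  proof -
    obtain z where z: "a < z" "z < b"
      "arc_ratio b - arc_ratio a = (b - a) * ((z * arc_ratio z - 1) / (1 - z\<^sup>2))"
    proof -
      have "continuous_on {a..b} arc_ratio"
        by (rule continuous_on_subset[OF continuous_on_arc_ratio]) (use ab in auto)
      moreover have "arc_ratio differentiable (at x)" if "a < x" "x < b" for x
        using DERIV_arc_ratio[of x] that ab by (auto simp: real_differentiable_def)
      ultimately obtain l z where "a < z" "z < b" "DERIV arc_ratio z :> l"
         "arc_ratio b - arc_ratio a = (b - a) * l"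
        using MVT[OF \<open>a < b\<close>] by blast
      moreover from this have "l = (z * arc_ratio z - 1) / (1 - z\<^sup>2)"
        using DERIV_arc_ratio[of z] ab DERIV_unique by (meson le_less_trans less_le_trans neg_less_0_iff_less zero_less_one less_trans)
      ultimately show ?thesis using that by blast
    qed
    have z01: "0 < z" "z < 1" using z ab by auto
    then have pos: "0 < 1 - z\<^sup>2" by (intro one_minus_square_pos) auto
    have "z\<^sup>2 \<le> z" using z01 by (simp add: power2_eq_square)
    also have "z \<le> z * arc_ratio z" using z01 arc_ratio_ge_1[of z] by simp
    finally have "- (1 - z\<^sup>2) \<le> z * arc_ratio z - 1" by simp
    moreover have "z * arc_ratio z - 1 \<le> 0" using z01 mult_arc_ratio_le_1[of z] by simp
    ultimately have "\<bar>(z * arc_ratio z - 1) / (1 - z\<^sup>2)\<bar> \<le> 1"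
      using pos by (simp add: abs_le_iff field_simps)
    then have "(b - a) * \<bar>(z * arc_ratio z - 1) / (1 - z\<^sup>2)\<bar> \<le> (b - a) * 1"
      using ab by (intro mult_left_mono) auto
    then show ?thesis using ab by (simp only: z(3) abs_mult) simp
  qed
  show "dist (arc_ratio x) (arc_ratio y) \<le> 1 * dist x y" if "x \<in> {0..1}" "y \<in> {0..1}" for x y
    using *[of x y] *[of y x] that by (cases x y rule: linorder_cases) (auto simp: dist_real_def)
qed simp

text \<open>
  The function \<open>arccos\<close> is not differentiable at \<open>1\<close>, but its square equals
  \<open>\<psi>\<^sup>2 (1 - c) (1 + c)\<close> with \<open>\<psi>\<close> continuous there, so its difference quotient converges to \<open>-2\<close>.
  This is what makes the kernel differentiable on the diagonal.
\<close>

lemma arccos_square_has_derivative: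
  assumes "-1 < c" "c \<le> 1"
  shows "((\<lambda>c. (arccos c)\<^sup>2) has_real_derivative - 2 * arc_ratio c) (at c within {-1..1})"
proof (cases "c = 1")
  case True
  have "((\<lambda>x. - (arc_ratio x)\<^sup>2 * (1 + x)) \<longlongrightarrow> - 2 * arc_ratio 1) (at 1 within {-1..1})"
    using tendsto_mult[OF tendsto_minus[OF tendsto_power[OF arc_ratio_tendsto_1, of 2]] tendsto_add[OF tendsto_const[of 1] tendsto_ident_at]]
    by (simp add: arc_ratio_def[of 1])
  moreover have "\<forall>\<^sub>F x in at 1 within {-1..1}.
      - (arc_ratio x)\<^sup>2 * (1 + x) = ((arccos x)\<^sup>2 - (arccos 1)\<^sup>2) / (x - 1)"
    unfolding eventually_at_topological
  proof (intro exI[of _ "{-1<..}"] conjI ballI impI)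
    fix x :: real assume "x \<in> {-1<..}" "x \<noteq> 1" "x \<in> {-1..1}"
    then show "- (arc_ratio x)\<^sup>2 * (1 + x) = ((arccos x)\<^sup>2 - (arccos 1)\<^sup>2) / (x - 1)"
      using arccos_square_eq[of x] by (simp add: field_simps power2_eq_square)
  qed auto
  ultimately show ?thesis
    unfolding True has_field_derivative_iff by (rule Lim_transform_eventually)
next
  case False
  then have "c < 1" using assms by simp
  with assms show ?thesis
    by (auto intro!: derivative_eq_intros simp: arc_ratio_def divide_simps)
qed

text \<open>
  The strength with which two points at angle \<open>\<theta>\<close> attract each other, as a function of \<open>cos \<theta>\<close>.
\<close>

definition attraction :: "(real \<Rightarrow> real) \<Rightarrow> real \<Rightarrow> real" where
  "attraction g' c = 2 * g' ((arccos c)\<^sup>2) * arc_ratio c"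

lemma sphere_inner_bounds:
  fixes x y :: "'a::real_inner"
  assumes "norm x = 1" "norm y = 1"
  shows "x \<bullet> y \<in> {-1..1}"
  using Cauchy_Schwarz_ineq2[of x y] assms by (auto simp: abs_le_iff)

text \<open>
  This is the formula \<open>- 2 g'(\<theta>\<^sup>2) log\<^sub>x y\<close>. The chain rule produces the derivative in the direction
  of \<open>y\<close>; the tangential projection comes for free, as the derivative of a multiple of
  \<open>z \<bullet> z - 1\<close>, which vanishes on the sphere and may be added to the kernel.
\<close>

lemma sphere_gradient_radial_kernel:
  fixes x y :: "'k::finite ambient"
  assumes xy: "x \<in> sphere 0 1" "y \<in> sphere 0 1" "-1 < x \<bullet> y"
    and f: "\<And>z. z \<in> sphere 0 1 \<Longrightarrow> f z = g ((sphere_dist z y)\<^sup>2)"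
    and g: "\<And>s. s \<ge> 0 \<Longrightarrow> (g has_real_derivative g' s) (at s within {0..})"
  shows "sphere_gradient f x = - (attraction g' (x \<bullet> y)) *\<^sub>R (y - (x \<bullet> y) *\<^sub>R x)"
proof (rule sphere_gradient_eq[OF xy(1)], unfold has_sphere_gradient_def, intro conjI)
  let ?c = "x \<bullet> y"
  let ?a = "attraction g' ?c"
  let ?v = "- ?a *\<^sub>R (y - ?c *\<^sub>R x)"
  have xx: "x \<bullet> x = 1" using xy(1) by (simp add: norm_eq_1)
  show "?v \<bullet> x = 0" using xx by (simp add: inner_diff_left inner_commute[of y x])
  have c: "-1 < ?c" "?c \<le> 1"
    using xy sphere_inner_bounds[of x y] by auto
  have "((\<lambda>c. g ((arccos c)\<^sup>2)) has_real_derivative - ?a) (at ?c within {-1..1})"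
    using DERIV_image_chain[OF _ arccos_square_has_derivative[OF c], of g "g' ((arccos ?c)\<^sup>2)"]
      DERIV_subset[OF g, of _ "(\<lambda>c. (arccos c)\<^sup>2) ` {-1..1}"]
    by (simp add: o_def image_subset_iff attraction_def mult_ac)
  then have "((\<lambda>c. g ((arccos c)\<^sup>2)) has_derivative (\<lambda>h. - ?a * h)) (at ?c within {-1..1})"
    unfolding has_field_derivative_def .
  moreover have "(\<lambda>z. z \<bullet> y) ` sphere 0 1 \<subseteq> {-1..1}"
    using xy(2) sphere_inner_bounds[of _ y] by auto
  ultimately have "((\<lambda>c. g ((arccos c)\<^sup>2)) has_derivative (\<lambda>h. - ?a * h))
      (at ?c within (\<lambda>z. z \<bullet> y) ` sphere 0 1)"
    by (rule has_derivative_subset)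
  from has_derivative_in_compose[OF _ this, of "\<lambda>h. h \<bullet> y"]
  have "((\<lambda>z. g ((sphere_dist z y)\<^sup>2)) has_derivative (\<lambda>h. - ?a * (h \<bullet> y))) (at x within sphere 0 1)"
    by (simp add: sphere_dist_def bounded_linear_imp_has_derivative bounded_linear_inner_left)
  moreover have "((\<lambda>z. (?a * ?c / 2) * (z \<bullet> z - 1)) has_derivative (\<lambda>h. (?a * ?c) * (x \<bullet> h)))
      (at x within sphere 0 1)"
    by (auto intro!: derivative_eq_intros simp: inner_commute)
  ultimately have "((\<lambda>z. g ((sphere_dist z y)\<^sup>2) + (?a * ?c / 2) * (z \<bullet> z - 1)) has_derivative
      (\<lambda>h. - ?a * (h \<bullet> y) + (?a * ?c) * (x \<bullet> h))) (at x within sphere 0 1)"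
    by (rule has_derivative_add)
  moreover have "(\<lambda>h. - ?a * (h \<bullet> y) + (?a * ?c) * (x \<bullet> h)) = (\<lambda>h. ?v \<bullet> h)"
    by (simp add: fun_eq_iff inner_diff_left inner_commute[of _ y] algebra_simps)
  ultimately have "((\<lambda>z. g ((sphere_dist z y)\<^sup>2) + (?a * ?c / 2) * (z \<bullet> z - 1)) has_derivative
      (\<lambda>h. ?v \<bullet> h)) (at x within sphere 0 1)" by simp
  then show "(f has_derivative (\<lambda>h. ?v \<bullet> h)) (at x within sphere 0 1)"
    by (rule has_derivative_transform[OF xy(1), rotated]) (auto simp: f norm_eq_1)
qed

section \<open>Bounds for the attraction profile\<close>

lemma arccos_square_lipschitz:
  assumes "a \<in> {0..1}" "b \<in> {0..1}"
  shows "\<bar>(arccos a)\<^sup>2 - (arccos b)\<^sup>2\<bar> \<le> 4 * \<bar>a - b\<bar>"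
proof -
  have "norm ((arccos a)\<^sup>2 - (arccos b)\<^sup>2) \<le> 4 * norm (a - b)"
  proof (rule field_differentiable_bound[OF convex_real_interval(5)[of 0 1], of "\<lambda>c. (arccos c)\<^sup>2"])
    fix c :: real assume c: "c \<in> {0..1}"
    show "((\<lambda>c. (arccos c)\<^sup>2) has_field_derivative - 2 * arc_ratio c) (at c within {0..1})"
      by (rule DERIV_subset[OF arccos_square_has_derivative]) (use c in auto)
    have "\<bar>arc_ratio c - arc_ratio 1\<bar> \<le> \<bar>c - 1\<bar>"
      using lipschitz_onD[OF arc_ratio_lipschitz c, of 1] by (simp add: dist_real_def)
    then show "norm (- 2 * arc_ratio c) \<le> 4"
      using c by (auto simp: arc_ratio_def[of 1])
  qed (use assms in auto)
  then show ?thesis by simp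
qed

lemma attraction_lipschitz:
  fixes g' :: "real \<Rightarrow> real"
  assumes "local_lipschitz (UNIV :: real set) {0..} (\<lambda>_. g')"
  obtains L where "L-lipschitz_on {0..1} (attraction g')"
proof -
  let ?X = "{0..(pi)\<^sup>2}"
  have "local_lipschitz {0::real} ?X (\<lambda>_. g')"
    by (rule local_lipschitz_subset[OF assms]) auto
  from local_lipschitz_compact_implies_lipschitz[OF this]
  obtain M where "M-lipschitz_on ?X g'" by auto
  note M = lipschitz_on_nonneg[OF this] lipschitz_onD[OF this]
  define s where "s c = (arccos c)\<^sup>2" for c
  have s: "s c \<in> ?X" if "c \<in> {0..1}" for c
    using that arccos_lbound[of c] arccos_ubound[of c] by (auto simp: s_def intro: power_mono)
  have ratio: "0 \<le> arc_ratio c \<and> arc_ratio c \<le> 2" if "c \<in> {0..1}" for c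
    using lipschitz_onD[OF arc_ratio_lipschitz that, of 1] that arc_ratio_ge_1[of c]
    by (auto simp: dist_real_def arc_ratio_def[of 1])
  define G where "G = \<bar>g' 0\<bar> + M * pi\<^sup>2"
  have G: "\<bar>g' (s c)\<bar> \<le> G" if "c \<in> {0..1}" for c
  proof -
    have "\<bar>g' (s c) - g' 0\<bar> \<le> M * \<bar>s c - 0\<bar>"
      using M(2)[OF s[OF that], of 0] by (simp add: dist_real_def)
    also have "\<dots> \<le> M * pi\<^sup>2" using s[OF that] M(1) by (intro mult_left_mono) auto
    finally show ?thesis by (simp add: G_def)
  qed
  have "(2 * (G + 8 * M))-lipschitz_on {0..1} (attraction g')"
  proof (rule lipschitz_onI)
    fix a b :: real assume a: "a \<in> {0..1}" and b: "b \<in> {0..1}"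
    have "\<bar>g' (s a) - g' (s b)\<bar> \<le> M * \<bar>s a - s b\<bar>"
      using M(2)[OF s[OF a] s[OF b]] by (simp add: dist_real_def)
    also have "\<dots> \<le> M * (4 * \<bar>a - b\<bar>)"
      using arccos_square_lipschitz[OF a b] M(1) by (intro mult_left_mono) (auto simp: s_def)
    finally have 1: "\<bar>g' (s a) - g' (s b)\<bar> \<le> M * (4 * \<bar>a - b\<bar>)" .
    have 2: "\<bar>arc_ratio a - arc_ratio b\<bar> \<le> \<bar>a - b\<bar>"
      using lipschitz_onD[OF arc_ratio_lipschitz a b] by (simp add: dist_real_def)
    have "attraction g' a - attraction g' b
        = 2 * (g' (s a) * (arc_ratio a - arc_ratio b) + (g' (s a) - g' (s b)) * arc_ratio b)"
      by (simp add: attraction_def s_def algebra_simps)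
    then have "\<bar>attraction g' a - attraction g' b\<bar>
        = 2 * \<bar>g' (s a) * (arc_ratio a - arc_ratio b) + (g' (s a) - g' (s b)) * arc_ratio b\<bar>"
      by (simp only: abs_mult abs_numeral)
    also have "\<dots>
        \<le> 2 * (\<bar>g' (s a)\<bar> * \<bar>arc_ratio a - arc_ratio b\<bar> + \<bar>g' (s a) - g' (s b)\<bar> * \<bar>arc_ratio b\<bar>)"
      unfolding abs_mult[symmetric] by (intro mult_left_mono abs_triangle_ineq) simp
    also have "\<dots> \<le> 2 * (G * \<bar>a - b\<bar> + (M * (4 * \<bar>a - b\<bar>)) * 2)"
      using G[OF a] 1 2 ratio[OF b] M(1)
      by (intro mult_left_mono add_mono mult_mono) (auto intro: order_trans[OF abs_ge_zero])
    finally show "dist (attraction g' a) (attraction g' b) \<le> 2 * (G + 8 * M) * dist a b"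
      by (simp add: dist_real_def algebra_simps)
  next
    show "0 \<le> 2 * (G + 8 * M)" using M(1) by (simp add: G_def)
  qed
  then show ?thesis by (rule that)
qed

lemma attraction_nonneg:
  assumes "\<And>s. 0 \<le> s \<Longrightarrow> 0 \<le> g' s" "-1 < c" "c \<le> 1"
  shows "0 \<le> attraction g' c"
  using assms arc_ratio_ge_1[of c] by (simp add: attraction_def)

text \<open>
  The factor \<open>\<theta> / sin \<theta>\<close> is at least \<open>1\<close>, so the power bound on \<open>g'\<close> carries over; at cosine
  at most \<open>1 - \<delta>\<close> the angle is at least \<open>arccos (1 - \<delta>) > 0\<close>.
\<close>

lemma attraction_bounded_below:
  assumes r: "0 < r" "r < pi / 4" and C: "0 < C" "0 \<le> \<alpha>"
    and g': "\<And>s. s \<in> {0..4 * r\<^sup>2} \<Longrightarrow> C * rpow s \<alpha> \<le> g' s"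
    and \<delta>: "0 < \<delta>"
  shows "\<exists>p>0. \<forall>c\<in>{cos (2 * r)..1 - \<delta>}. p \<le> attraction g' c"
proof (cases "cos (2 * r) \<le> 1 - \<delta>")
  case True
  have cos_pos: "0 < cos (2 * r)" using r by (intro cos_gt_zero_pi) auto
  define \<theta> where "\<theta> = arccos (1 - \<delta>)"
  have "0 < \<theta>" using arccos_less_arccos[of "1 - \<delta>" 1] True cos_pos \<delta> by (simp add: \<theta>_def)
  then have pos: "0 < rpow (\<theta>\<^sup>2) \<alpha>" by (simp add: rpow_def)
  have "2 * (C * rpow (\<theta>\<^sup>2) \<alpha>) \<le> attraction g' c" if c: "c \<in> {cos (2 * r)..1 - \<delta>}" for c
  proof -
    have c01: "0 < c" "c < 1" using c cos_pos \<delta> by auto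
    have "\<theta> \<le> arccos c" unfolding \<theta>_def using c c01 \<delta> by (intro arccos_le_arccos) auto
    then have "rpow (\<theta>\<^sup>2) \<alpha> \<le> rpow ((arccos c)\<^sup>2) \<alpha>"
      using C(2) \<open>0 < \<theta>\<close> by (auto simp: rpow_def intro!: powr_mono2 power_mono)
    moreover have "arccos c \<le> arccos (cos (2 * r))" using c c01 cos_pos by (intro arccos_le_arccos) auto
    then have "arccos c \<le> 2 * r" using r by (simp add: arccos_cos)
    then have "(arccos c)\<^sup>2 \<le> (2 * r)\<^sup>2" using c01 by (intro power_mono arccos_lbound) auto
    then have "C * rpow ((arccos c)\<^sup>2) \<alpha> \<le> g' ((arccos c)\<^sup>2)" by (intro g') (simp add: power_mult_distrib)
    ultimately have *: "C * rpow (\<theta>\<^sup>2) \<alpha> \<le> g' ((arccos c)\<^sup>2)"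
      using C(1) by (meson mult_left_mono less_imp_le order_trans)
    have "0 < C * rpow (\<theta>\<^sup>2) \<alpha>" using C(1) pos by simp
    then have "g' ((arccos c)\<^sup>2) * 1 \<le> g' ((arccos c)\<^sup>2) * arc_ratio c"
      using * c01 by (intro mult_left_mono arc_ratio_ge_1) auto
    then show ?thesis using * by (simp add: attraction_def)
  qed
  then show ?thesis using C(1) pos by (intro exI[of _ "2 * (C * rpow (\<theta>\<^sup>2) \<alpha>)"]) auto
qed (auto intro: exI[of _ 1])

section \<open>A globally Lipschitz extension of the flow\<close>

text \<open>
  Squaring the positive part makes it differentiable, so that one-sided bounds can be proved by
  Gronwall's inequality.
\<close>

lemma DERIV_square_pos_part:
  "((\<lambda>s. (max 0 s)\<^sup>2) has_real_derivative 2 * max 0 s) (at s)" for s :: real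
proof -
  consider "s < 0" | "s = 0" | "s > 0" by linarith
  then show ?thesis
  proof cases
    case 1
    then have "\<forall>\<^sub>F u in nhds s. (max 0 u)\<^sup>2 = (\<lambda>_. 0) u"
      by (auto simp: eventually_nhds intro!: exI[of _ "{..<0}"])
    from DERIV_cong_ev[OF refl this, of _ 0] show ?thesis using 1 by simp
  next
    case 2
    have "\<forall>z. (max 0 z)\<^sup>2 - (max 0 0)\<^sup>2 = max 0 z * (z - (0::real))"
      by (auto simp: max_def power2_eq_square)
    moreover have "isCont (max (0::real)) 0" by (intro continuous_intros)
    ultimately show ?thesis using 2 unfolding CARAT_DERIV by (intro exI[of _ "max 0"]) auto
  next
    case 3
    then have "\<forall>\<^sub>F u in nhds s. (max 0 u)\<^sup>2 = u\<^sup>2"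
      by (auto simp: eventually_nhds intro!: exI[of _ "{0<..}"])
    moreover have "((\<lambda>u. u\<^sup>2) has_real_derivative 2 * max 0 s) (at s)"
      using 3 by (auto intro!: derivative_eq_intros)
    ultimately show ?thesis using DERIV_cong_ev[of s s "\<lambda>u. (max 0 u)\<^sup>2" "\<lambda>u. u\<^sup>2"] by simp
  qed
qed

text \<open>
  With \<open>a\<^sub>i\<^sub>j = \<phi>(c\<^sub>i\<^sub>j)\<close> this turns the derivative of \<open>|\<Sum>\<^sub>i x\<^sub>i|\<^sup>2\<close>, whose terms have no sign, into
  a sum whose terms are nonnegative when all \<open>c\<^sub>i\<^sub>j\<close> lie in \<open>[0, 1]\<close>: exchanging \<open>i\<close> and \<open>j\<close> and averaging produces the factor
  \<open>1 - c\<^sub>i\<^sub>j\<close>.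
\<close>

lemma sum_symmetrize:
  fixes a c :: "'i \<Rightarrow> 'i \<Rightarrow> real"
  assumes a: "\<And>i j. a i j = a j i" and c: "\<And>i j. c i j = c j i"
  shows "2 * (\<Sum>i\<in>I. \<Sum>j\<in>I. \<Sum>k\<in>I. a i j * (c j k - c i j * c i k))
       = (\<Sum>i\<in>I. \<Sum>j\<in>I. \<Sum>k\<in>I. a i j * (1 - c i j) * (c i k + c j k))"
proof -
  let ?f = "\<lambda>i j. \<Sum>k\<in>I. a i j * (c j k - c i j * c i k)"
  have "2 * (\<Sum>i\<in>I. \<Sum>j\<in>I. ?f i j) = (\<Sum>i\<in>I. \<Sum>j\<in>I. ?f i j) + (\<Sum>i\<in>I. \<Sum>j\<in>I. ?f j i)"
    using sum.swap[of ?f I I] by simp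
  also have "\<dots> = (\<Sum>i\<in>I. \<Sum>j\<in>I. \<Sum>k\<in>I. a i j * (c j k - c i j * c i k) + a j i * (c i k - c j i * c j k))"
    by (simp add: sum.distrib)
  also have "\<dots> = (\<Sum>i\<in>I. \<Sum>j\<in>I. \<Sum>k\<in>I. a i j * (1 - c i j) * (c i k + c j k))"
  proof (intro sum.cong refl)
    fix i j k
    show "a i j * (c j k - c i j * c i k) + a j i * (c i k - c j i * c j k)
        = a i j * (1 - c i j) * (c i k + c j k)"
      unfolding a[of j i] c[of j i] by (simp add: algebra_simps)
  qed
  finally show ?thesis .
qed

text \<open>
  Projection onto the ball, rather than normalization, makes the extended field Lipschitz everywhere,
  including at the origin.
\<close>

abbreviation ball_proj :: "'a::euclidean_space \<Rightarrow> 'a" where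
  "ball_proj \<equiv> closest_point (cball 0 1)"

lemma ball_proj_norm_le_1: "norm (ball_proj x) \<le> 1"
  using closest_point_in_set[of "cball 0 1" x] by auto

lemma ball_proj_outside:
  fixes x :: "'a::euclidean_space"
  assumes "1 \<le> norm x"
  shows "ball_proj x = x /\<^sub>R norm x"
proof (rule closest_point_unique[symmetric])
  show "x /\<^sub>R norm x \<in> cball 0 1" using assms by (auto simp: field_simps)
  show "\<forall>z\<in>cball 0 1. dist x (x /\<^sub>R norm x) \<le> dist x z"
  proof
    fix z :: 'a assume z: "z \<in> cball 0 1"
    have "x - x /\<^sub>R norm x = (1 - inverse (norm x)) *\<^sub>R x" by (simp add: algebra_simps)
    moreover have "inverse (norm x) \<le> 1" using assms by (simp add: inverse_le_1_iff)
    ultimately have "dist x (x /\<^sub>R norm x) = (1 - inverse (norm x)) * norm x"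
      by (simp only: dist_norm norm_scaleR abs_of_nonneg diff_ge_0_iff_ge)
    also have "\<dots> = norm x - 1" using assms by (auto simp: field_simps)
    also have "\<dots> \<le> norm x - norm z" using z by simp
    also have "\<dots> \<le> dist x z" by (simp add: dist_norm norm_triangle_ineq2)
    finally show "dist x (x /\<^sub>R norm x) \<le> dist x z" .
  qed
qed auto

lemma ball_proj_sphere: "norm x = 1 \<Longrightarrow> ball_proj x = x"
  by (simp add: closest_point_self)

lemma ball_proj_lipschitz: "norm (ball_proj x - ball_proj y) \<le> norm (x - y)"
  using closest_point_lipschitz[of "cball 0 1" x y] by (simp add: dist_norm)

text \<open>
  The contribution of a particle at \<open>q\<close> to the velocity of a particle at \<open>p\<close>. For unit vectors the
  bracket is the tangential part of \<open>q\<close> at \<open>p\<close>.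
\<close>

definition pull :: "(real \<Rightarrow> real) \<Rightarrow> 'a::real_inner \<Rightarrow> 'a \<Rightarrow> 'a" where
  "pull \<phi> p q = \<phi> (p \<bullet> q) *\<^sub>R (q - (p \<bullet> q) *\<^sub>R p)"

lemma norm_tangential_le_2:
  fixes p q :: "'a::real_inner"
  assumes "norm p \<le> 1" "norm q \<le> 1"
  shows "norm (q - (p \<bullet> q) *\<^sub>R p) \<le> 2" "\<bar>p \<bullet> q\<bar> \<le> 1"
proof -
  have "\<bar>p \<bullet> q\<bar> \<le> norm p * norm q" by (rule Cauchy_Schwarz_ineq2)
  also have "\<dots> \<le> 1 * 1" using assms by (intro mult_mono) auto
  finally show *: "\<bar>p \<bullet> q\<bar> \<le> 1" by simp
  have "norm (q - (p \<bullet> q) *\<^sub>R p) \<le> norm q + \<bar>p \<bullet> q\<bar> * norm p"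
    by (rule order_trans[OF norm_triangle_ineq4]) simp
  also have "\<dots> \<le> 1 + 1 * 1" using assms * by (intro add_mono mult_mono) auto
  finally show "norm (q - (p \<bullet> q) *\<^sub>R p) \<le> 2" by simp
qed

lemma pull_lipschitz:
  fixes p q p' q' :: "'a::real_inner"
  assumes lip: "\<And>c d. \<bar>\<phi> c - \<phi> d\<bar> \<le> L * \<bar>c - d\<bar>" and bound: "\<And>c. \<bar>\<phi> c\<bar> \<le> A"
    and norms: "norm p \<le> 1" "norm q \<le> 1" "norm p' \<le> 1" "norm q' \<le> 1"
  shows "norm (pull \<phi> p q - pull \<phi> p' q') \<le> (2 * L + 3 * A) * (norm (p - p') + norm (q - q'))"
proof -
  define \<delta> where "\<delta> = norm (p - p') + norm (q - q')"
  have l: "L \<ge> 0" using lip[of 0 1] by (smt (verit) abs_ge_zero mult_cancel_left1)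
  have "p \<bullet> q - p' \<bullet> q' = (p - p') \<bullet> q + p' \<bullet> (q - q')"
    by (simp add: inner_diff_left inner_diff_right)
  then have "\<bar>p \<bullet> q - p' \<bullet> q'\<bar> \<le> norm (p - p') * norm q + norm p' * norm (q - q')"
    by (smt (verit) Cauchy_Schwarz_ineq2)
  also have "\<dots> \<le> norm (p - p') * 1 + 1 * norm (q - q')"
    using norms by (intro add_mono mult_mono) auto
  finally have c: "\<bar>p \<bullet> q - p' \<bullet> q'\<bar> \<le> \<delta>" by (simp add: \<delta>_def)
  let ?w = "q - (p \<bullet> q) *\<^sub>R p" and ?w' = "q' - (p' \<bullet> q') *\<^sub>R p'"
  have "?w - ?w' = (q - q') - ((p \<bullet> q - p' \<bullet> q') *\<^sub>R p + (p' \<bullet> q') *\<^sub>R (p - p'))"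
    by (simp add: algebra_simps)
  then have "norm (?w - ?w') \<le> norm (q - q') + (\<bar>p \<bullet> q - p' \<bullet> q'\<bar> * norm p + \<bar>p' \<bullet> q'\<bar> * norm (p - p'))"
    by (smt (verit) norm_triangle_ineq4 norm_triangle_ineq norm_scaleR)
  also have "\<dots> \<le> norm (q - q') + (\<delta> * 1 + 1 * norm (p - p'))"
    using norms c norm_tangential_le_2(2)[OF norms(3,4)] by (intro add_mono mult_mono) auto
  finally have w: "norm (?w - ?w') \<le> 2 * \<delta>" by (simp add: \<delta>_def)
  have "pull \<phi> p q - pull \<phi> p' q' = (\<phi> (p \<bullet> q) - \<phi> (p' \<bullet> q')) *\<^sub>R ?w + \<phi> (p' \<bullet> q') *\<^sub>R (?w - ?w')"
    by (simp add: pull_def algebra_simps)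
  then have "norm (pull \<phi> p q - pull \<phi> p' q')
      \<le> \<bar>\<phi> (p \<bullet> q) - \<phi> (p' \<bullet> q')\<bar> * norm ?w + \<bar>\<phi> (p' \<bullet> q')\<bar> * norm (?w - ?w')"
    by (metis norm_triangle_ineq norm_scaleR)
  also have "\<dots> \<le> (L * \<delta>) * 2 + A * (2 * \<delta>)"
  proof (intro add_mono mult_mono)
    show "\<bar>\<phi> (p \<bullet> q) - \<phi> (p' \<bullet> q')\<bar> \<le> L * \<delta>"
      using lip c l by (meson mult_left_mono order_trans)
    show "norm ?w \<le> 2" by (rule norm_tangential_le_2[OF norms(1,2)])
  qed (use l bound w in \<open>auto simp: \<delta>_def intro: order_trans[OF abs_ge_zero bound]\<close>)
  also have "\<dots> \<le> (2 * L + 3 * A) * \<delta>"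
    using bound[of 0] by (simp add: algebra_simps \<delta>_def)
  finally show ?thesis by (simp add: \<delta>_def)
qed

text \<open>
  The system with an attraction profile \<open>\<phi>\<close> that is nonnegative, bounded and Lipschitz on the
  whole line, as obtained from the true profile by clamping its argument.
\<close>

locale sphere_flow =
  fixes n :: nat and \<phi> :: "real \<Rightarrow> real" and A L :: real
  assumes n_pos: "0 < n"
    and \<phi>_nonneg: "0 \<le> \<phi> c"
    and \<phi>_le: "\<phi> c \<le> A"
    and \<phi>_lipschitz: "\<bar>\<phi> c - \<phi> d\<bar> \<le> L * \<bar>c - d\<bar>"
begin

text \<open>
  Particles outside the index range do not move, which makes the Lipschitz bound uniform in all
  indices.
\<close>

definition velocity :: "(nat \<Rightarrow> 'a::euclidean_space) \<Rightarrow> nat \<Rightarrow> 'a" where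
  "velocity u i = (if i \<in> {1..n}
     then (1 / real n) *\<^sub>R (\<Sum>j=1..n. pull \<phi> (ball_proj (u i)) (ball_proj (u j))) else 0)"

definition solution :: "(nat \<Rightarrow> real \<Rightarrow> 'a::euclidean_space) \<Rightarrow> bool" where
  "solution x \<longleftrightarrow> (\<forall>i\<in>{1..n}. \<forall>t\<ge>0.
     (x i has_vector_derivative velocity (\<lambda>j. x j t) i) (at t within {0..}))"

lemma A_nonneg: "0 \<le> A"
  using \<phi>_nonneg \<phi>_le by (rule order_trans)

lemma lipschitz_const_nonneg: "0 \<le> L"
  using \<phi>_lipschitz[of 0 1] by (smt (verit) abs_ge_zero mult_cancel_left1)

lemma abs_\<phi>_le: "\<bar>\<phi> c\<bar> \<le> A"
  using \<phi>_nonneg[of c] \<phi>_le[of c] by simp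

lemma velocity_bounded: "norm (velocity u i) \<le> 2 * A"
proof (cases "i \<in> {1..n}")
  case True
  have "norm (\<Sum>j=1..n. pull \<phi> (ball_proj (u i)) (ball_proj (u j))) \<le> (\<Sum>j=1..n. A * 2)"
    unfolding pull_def norm_scaleR
    by (intro sum_norm_le order_trans[OF eq_refl[OF norm_scaleR] mult_mono]
      norm_tangential_le_2 ball_proj_norm_le_1) (auto simp: abs_\<phi>_le A_nonneg)
  then show ?thesis using True n_pos by (simp add: velocity_def field_simps)
next
  case False
  then show ?thesis using A_nonneg by (simp only: velocity_def if_False norm_zero)
qed

lemma velocity_lipschitz:
  "norm (velocity u i - velocity v i) \<le> 2 * (2 * L + 3 * A) * (\<Sum>j\<in>{1..n}. norm (u j - v j))"
proof (cases "i \<in> {1..n}")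
  case True
  let ?K = "2 * L + 3 * A"
  let ?s = "\<Sum>j\<in>{1..n}. norm (u j - v j)"
  have K: "0 \<le> ?K" using A_nonneg lipschitz_const_nonneg by simp
  have "norm ((\<Sum>j=1..n. pull \<phi> (ball_proj (u i)) (ball_proj (u j)))
      - (\<Sum>j=1..n. pull \<phi> (ball_proj (v i)) (ball_proj (v j))))
    \<le> (\<Sum>j=1..n. ?K * (norm (u i - v i) + norm (u j - v j)))"
    unfolding sum_subtractf[symmetric]
  proof (rule sum_norm_le)
    fix j
    have "norm (pull \<phi> (ball_proj (u i)) (ball_proj (u j)) - pull \<phi> (ball_proj (v i)) (ball_proj (v j)))
       \<le> ?K * (norm (ball_proj (u i) - ball_proj (v i)) + norm (ball_proj (u j) - ball_proj (v j)))"
      by (intro pull_lipschitz \<phi>_lipschitz abs_\<phi>_le ball_proj_norm_le_1)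
    also have "\<dots> \<le> ?K * (norm (u i - v i) + norm (u j - v j))"
      by (intro mult_left_mono add_mono ball_proj_lipschitz K)
    finally show "norm (pull \<phi> (ball_proj (u i)) (ball_proj (u j)) - pull \<phi> (ball_proj (v i)) (ball_proj (v j)))
       \<le> ?K * (norm (u i - v i) + norm (u j - v j))" .
  qed
  also have "\<dots> = ?K * (real n * norm (u i - v i) + ?s)"
    by (simp add: sum_distrib_left[symmetric] sum.distrib)
  also have "\<dots> \<le> ?K * (real n * ?s + real n * ?s)"
  proof (intro mult_left_mono add_mono K)
    show "norm (u i - v i) \<le> ?s" using True by (intro member_le_sum) auto
    show "?s \<le> real n * ?s"
      using n_pos mult_right_mono[of 1 "real n" ?s] by (simp add: sum_nonneg)
  qed simp
  finally have "norm ((\<Sum>j=1..n. pull \<phi> (ball_proj (u i)) (ball_proj (u j)))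
      - (\<Sum>j=1..n. pull \<phi> (ball_proj (v i)) (ball_proj (v j)))) / real n \<le> 2 * ?K * ?s"
    using n_pos by (simp add: field_simps)
  then show ?thesis using True n_pos
    by (simp add: velocity_def scaleR_diff_right[symmetric] del: scaleR_diff_right)
next
  case False
  then have "velocity u i = 0" "velocity v i = 0" by (simp_all only: velocity_def if_False)
  then show ?thesis using A_nonneg lipschitz_const_nonneg by (simp add: sum_nonneg)
qed

lemma solution_exists:
  fixes x0 :: "nat \<Rightarrow> 'a::euclidean_space"
  shows "\<exists>x. solution x \<and> (\<forall>i. x i 0 = x0 i)"
  using lipschitz_system_has_global_solution[of velocity, OF velocity_lipschitz velocity_bounded]
  by (metis solution_def)

lemma velocity_on_sphere:
  assumes "\<And>j. j \<in> {1..n} \<Longrightarrow> norm (u j) = 1" "i \<in> {1..n}"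
  shows "velocity u i = (1 / real n) *\<^sub>R (\<Sum>j=1..n. pull \<phi> (u i) (u j))"
  using assms by (simp add: velocity_def ball_proj_sphere)

lemma solutionD:
  assumes "solution x" "i \<in> {1..n}"
  shows "t \<ge> 0 \<Longrightarrow> (x i has_vector_derivative velocity (\<lambda>j. x j t) i) (at t within {0..})"
    and "t > 0 \<Longrightarrow> (x i has_vector_derivative velocity (\<lambda>j. x j t) i) (at t)"
    and "continuous_on {0..T} (x i)"
proof -
  show *: "(x i has_vector_derivative velocity (\<lambda>j. x j t) i) (at t within {0..})" if "t \<ge> 0" for t
    using assms that by (simp add: solution_def)
  show "(x i has_vector_derivative velocity (\<lambda>j. x j t) i) (at t)" if "t > 0"
    using *[of t] that by (simp add: at_within_interior[of t "{0..}"] interior_Ici[of "-1"])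
  have "continuous_on {0..} (x i)"
    using * by (meson atLeast_iff continuous_on_eq_continuous_within has_vector_derivative_continuous)
  then show "continuous_on {0..T} (x i)" by (rule continuous_on_subset) auto
qed

lemma inner_has_real_derivative:
  assumes "(f has_vector_derivative f') F" "(g has_vector_derivative g') F" "F = at t within S"
  shows "((\<lambda>s. f s \<bullet> g s) has_real_derivative (f' \<bullet> g t + f t \<bullet> g')) F"
  using bounded_bilinear.has_vector_derivative[OF bounded_bilinear_inner, of f f' t S g g'] assms
  by (simp add: has_real_derivative_iff_has_vector_derivative add.commute)

text \<open>
  Inside the ball the radial velocity carries the factor \<open>1 - |u\<^sub>i|\<^sup>2\<close>; outside, the position is
  parallel to its projection, to which every pull is orthogonal. Hence the sphere is invariant, and
  Gronwall's inequality for \<open>(1 - |x\<^sub>i|\<^sup>2)\<^sup>2\<close> shows it.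
\<close>

lemma inner_velocity_bound:
  fixes u :: "nat \<Rightarrow> 'a::euclidean_space"
  assumes i: "i \<in> {1..n}"
  shows "\<bar>u i \<bullet> velocity u i\<bar> \<le> A * \<bar>1 - (norm (u i))\<^sup>2\<bar>"
proof -
  have term_le: "\<bar>u i \<bullet> pull \<phi> (ball_proj (u i)) q\<bar> \<le> A * \<bar>1 - (norm (u i))\<^sup>2\<bar>"
    if q: "norm q \<le> 1" for q
  proof (cases "norm (u i) \<le> 1")
    case True
    then have p: "ball_proj (u i) = u i" by (simp add: closest_point_self)
    have "u i \<bullet> pull \<phi> (ball_proj (u i)) q = (\<phi> (u i \<bullet> q) * (u i \<bullet> q)) * (1 - (norm (u i))\<^sup>2)"
      by (simp add: p pull_def inner_diff_right power2_norm_eq_inner algebra_simps)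
    moreover have "\<bar>\<phi> (u i \<bullet> q) * (u i \<bullet> q)\<bar> \<le> A * 1"
      unfolding abs_mult using norm_tangential_le_2(2)[OF True q]
      by (intro mult_mono) (auto simp: abs_\<phi>_le A_nonneg)
    ultimately show ?thesis by (simp add: abs_mult mult_right_mono)
  next
    case False
    then have "u i \<noteq> 0" by auto
    have "u i \<bullet> pull \<phi> (ball_proj (u i)) q = 0"
      using False \<open>u i \<noteq> 0\<close>
      by (simp add: ball_proj_outside pull_def inner_diff_right dot_square_norm power2_eq_square field_simps)
    then show ?thesis using A_nonneg by simp
  qed
  have "\<bar>u i \<bullet> (\<Sum>j=1..n. pull \<phi> (ball_proj (u i)) (ball_proj (u j)))\<bar>
      \<le> (\<Sum>j=1..n. A * \<bar>1 - (norm (u i))\<^sup>2\<bar>)"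
    unfolding inner_sum_right
    by (intro order_trans[OF sum_abs] sum_mono term_le ball_proj_norm_le_1)
  then show ?thesis using i n_pos by (simp add: velocity_def field_simps abs_mult)
qed

lemma solution_norm_eq_1:
  fixes x :: "nat \<Rightarrow> real \<Rightarrow> 'a::euclidean_space"
  assumes x: "solution x" and i: "i \<in> {1..n}" and "norm (x i 0) = 1" and "0 \<le> t"
  shows "norm (x i t) = 1"
proof -
  let ?w = "\<lambda>t. 1 - x i t \<bullet> x i t"
  have "(?w t)\<^sup>2 \<le> 0"
  proof (rule gronwall_nonpos[where M = "4 * A" and w = "\<lambda>t. (?w t)\<^sup>2"
        and w' = "\<lambda>t. - 4 * ?w t * (x i t \<bullet> velocity (\<lambda>j. x j t) i)", OF \<open>0 \<le> t\<close>])
    show "continuous_on {0..t} (\<lambda>t. (?w t)\<^sup>2)"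
      by (intro continuous_intros solutionD(3)[OF x i])
    fix s :: real assume s: "0 < s" "s < t"
    note d = solutionD(2)[OF x i s(1)]
    show "((\<lambda>t. (?w t)\<^sup>2) has_real_derivative
        - 4 * ?w s * (x i s \<bullet> velocity (\<lambda>j. x j s) i)) (at s)"
      by (auto intro!: derivative_eq_intros inner_has_real_derivative[OF d d refl] simp: inner_commute algebra_simps)
    have "- 4 * ?w s * (x i s \<bullet> velocity (\<lambda>j. x j s) i)
        \<le> 4 * (\<bar>?w s\<bar> * \<bar>x i s \<bullet> velocity (\<lambda>j. x j s) i\<bar>)"
      using abs_ge_minus_self[of "?w s * (x i s \<bullet> velocity (\<lambda>j. x j s) i)"] by (simp only: abs_mult)
    also have "\<dots> \<le> 4 * (\<bar>?w s\<bar> * (A * \<bar>?w s\<bar>))"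
      using inner_velocity_bound[OF i, of "\<lambda>j. x j s"]
      by (intro mult_left_mono) (auto simp: power2_norm_eq_inner)
    also have "\<dots> = 4 * A * (?w s)\<^sup>2" by (simp add: power2_eq_square abs_mult_self_eq mult_ac)
    finally show "- 4 * ?w s * (x i s \<bullet> velocity (\<lambda>j. x j s) i) \<le> 4 * A * (?w s)\<^sup>2" .
  qed (use assms in \<open>simp add: dot_square_norm\<close>)
  then have "x i t \<bullet> x i t = 1" by simp
  then show ?thesis by (simp add: norm_eq_1)
qed

text \<open>
  The height \<open>u\<^sub>i = x\<^sub>i \<bullet> e\<close> satisfies \<open>u\<^sub>i' = (1/n) \<Sum>\<^sub>j \<phi>(c\<^sub>i\<^sub>j) (u\<^sub>j - c\<^sub>i\<^sub>j u\<^sub>i)\<close>, and a lowest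
  particle of nonnegative height has \<open>u\<^sub>j \<ge> u\<^sub>i \<ge> c\<^sub>i\<^sub>j u\<^sub>i\<close>, so it rises. To avoid differentiating
  a minimum, the deficits \<open>v\<^sub>i = max 0 (m - u\<^sub>i)\<close> are estimated through the sum of their squares,
  using \<open>c\<^sub>i\<^sub>j u\<^sub>i - u\<^sub>j \<le> v\<^sub>i + v\<^sub>j\<close> below the level \<open>m\<close>.
\<close>

lemma solution_height_bound:
  fixes x :: "nat \<Rightarrow> real \<Rightarrow> 'a::euclidean_space"
  assumes x: "solution x" and norms: "\<And>i. i \<in> {1..n} \<Longrightarrow> norm (x i 0) = 1"
    and m: "0 \<le> m" "\<And>i. i \<in> {1..n} \<Longrightarrow> m \<le> x i 0 \<bullet> e"
    and i: "i \<in> {1..n}" and t: "0 \<le> t"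
  shows "m \<le> x i t \<bullet> e"
proof -
  define v where "v i t = max 0 (m - x i t \<bullet> e)" for i t
  define V where "V t = (\<Sum>i=1..n. (v i t)\<^sup>2)" for t
  let ?F = "\<lambda>i s. velocity (\<lambda>j. x j s) i"
  have "V t \<le> 0"
  proof (rule gronwall_nonpos[where M = "6 * A" and w = V
        and w' = "\<lambda>s. \<Sum>i=1..n. 2 * v i s * - (?F i s \<bullet> e)", OF t])
    show "continuous_on {0..t} V"
      unfolding V_def v_def by (intro continuous_intros solutionD(3)[OF x])
    show "V 0 \<le> 0" using m(2) by (simp add: V_def v_def max_absorb1)
    fix s :: real assume s: "0 < s" "s < t"
    show "(V has_real_derivative (\<Sum>i=1..n. 2 * v i s * - (?F i s \<bullet> e))) (at s)"
      unfolding V_def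
    proof (rule DERIV_sum)
      fix i assume i: "i \<in> {1..n}"
      have "((\<lambda>s. m - x i s \<bullet> e) has_real_derivative - (?F i s \<bullet> e)) (at s)"
        using inner_has_real_derivative[OF solutionD(2)[OF x i s(1)] has_vector_derivative_const refl, of e]
        by (auto intro!: derivative_eq_intros)
      from DERIV_chain2[OF DERIV_square_pos_part this]
      show "((\<lambda>s. (v i s)\<^sup>2) has_real_derivative 2 * v i s * - (?F i s \<bullet> e)) (at s)"
        by (simp add: v_def)
    qed
    have norm_s: "norm (x i s) = 1" if "i \<in> {1..n}" for i
      using solution_norm_eq_1[OF x that norms[OF that]] s by simp
    have pair: "v i s * - (pull \<phi> (x i s) (x j s) \<bullet> e) \<le> A * (2 * (v i s)\<^sup>2 + (v j s)\<^sup>2)"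
      if ij: "i \<in> {1..n}" "j \<in> {1..n}" for i j
    proof (cases "x i s \<bullet> e < m")
      case True
      let ?c = "x i s \<bullet> x j s"
      have vi: "v i s = m - x i s \<bullet> e" "0 \<le> v i s" and vj: "m - x j s \<bullet> e \<le> v j s" "0 \<le> v j s"
        using True by (auto simp: v_def)
      have "?c * (x i s \<bullet> e) \<le> \<bar>x i s \<bullet> e\<bar>"
      proof -
        have "\<bar>?c\<bar> \<le> 1" using norm_s ij by (intro norm_tangential_le_2) auto
        then have "\<bar>?c\<bar> * \<bar>x i s \<bullet> e\<bar> \<le> 1 * \<bar>x i s \<bullet> e\<bar>" by (rule mult_right_mono) simp
        then show ?thesis unfolding abs_mult[symmetric] by linarith
      qed
      then have *: "?c * (x i s \<bullet> e) - x j s \<bullet> e \<le> v i s + v j s"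
        using vi vj m(1) by linarith
      have "v i s * - (pull \<phi> (x i s) (x j s) \<bullet> e)
          = v i s * (\<phi> ?c * (?c * (x i s \<bullet> e) - x j s \<bullet> e))"
        by (simp add: pull_def inner_diff_left algebra_simps)
      also have "\<dots> \<le> v i s * (A * (v i s + v j s))"
      proof (rule mult_left_mono[OF _ vi(2)])
        have "\<phi> ?c * (?c * (x i s \<bullet> e) - x j s \<bullet> e) \<le> \<phi> ?c * (v i s + v j s)"
          by (rule mult_left_mono[OF * \<phi>_nonneg])
        also have "\<dots> \<le> A * (v i s + v j s)"
          using vi(2) vj(2) by (intro mult_right_mono \<phi>_le) auto
        finally show "\<phi> ?c * (?c * (x i s \<bullet> e) - x j s \<bullet> e) \<le> A * (v i s + v j s)" .
      qed
      also have "\<dots> = A * ((v i s)\<^sup>2 + v i s * v j s)" by (simp add: power2_eq_square algebra_simps)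
      also have "\<dots> \<le> A * (2 * (v i s)\<^sup>2 + (v j s)\<^sup>2)"
      proof (rule mult_left_mono[OF _ A_nonneg])
        have "0 \<le> (v i s - v j s)\<^sup>2" "0 \<le> (v i s)\<^sup>2" "0 \<le> (v j s)\<^sup>2" by auto
        then show "(v i s)\<^sup>2 + v i s * v j s \<le> 2 * (v i s)\<^sup>2 + (v j s)\<^sup>2"
          unfolding power2_diff by linarith
      qed
      finally show ?thesis .
    qed (use A_nonneg in \<open>simp add: v_def max_def\<close>)
    have "(\<Sum>i=1..n. 2 * v i s * - (?F i s \<bullet> e))
        = 2 / real n * (\<Sum>i=1..n. \<Sum>j=1..n. v i s * - (pull \<phi> (x i s) (x j s) \<bullet> e))"
      unfolding sum_distrib_left
    proof (intro sum.cong refl)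
      fix i assume "i \<in> {1..n}"
      then have "?F i s = (1 / real n) *\<^sub>R (\<Sum>j=1..n. pull \<phi> (x i s) (x j s))"
        using norm_s by (intro velocity_on_sphere) auto
      then show "2 * v i s * - (?F i s \<bullet> e)
          = (\<Sum>j=1..n. 2 / real n * (v i s * - (pull \<phi> (x i s) (x j s) \<bullet> e)))"
        by (simp add: inner_sum_left sum_distrib_left sum_negf mult_ac)
    qed
    also have "\<dots> \<le> 2 / real n * (\<Sum>i=1..n. \<Sum>j=1..n. A * (2 * (v i s)\<^sup>2 + (v j s)\<^sup>2))"
      by (intro mult_left_mono sum_mono pair) auto
    also have "(\<Sum>i=1..n. \<Sum>j=1..n. A * (2 * (v i s)\<^sup>2 + (v j s)\<^sup>2)) = 3 * real n * A * V s"
      by (simp add: V_def sum.distrib sum_distrib_left[symmetric] algebra_simps)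
    also have "2 / real n * \<dots> = 6 * A * V s" using n_pos by simp
    finally show "(\<Sum>i=1..n. 2 * v i s * - (?F i s \<bullet> e)) \<le> 6 * A * V s" .
  qed
  moreover have "(v i t)\<^sup>2 \<le> V t"
    unfolding V_def by (rule member_le_sum[OF i]) auto
  ultimately have "v i t = 0" by (metis power2_less_eq_zero_iff order_trans)
  then show ?thesis by (auto simp: v_def max_def split: if_splits)
qed

lemma solutions_agree:
  fixes x y :: "nat \<Rightarrow> real \<Rightarrow> 'a::euclidean_space"
  assumes cont: "\<And>i. i \<in> {1..n} \<Longrightarrow> continuous_on {0..T} (x i)"
      "\<And>i. i \<in> {1..n} \<Longrightarrow> continuous_on {0..T} (y i)"
    and der: "\<And>i t. i \<in> {1..n} \<Longrightarrow> 0 < t \<Longrightarrow> t < T \<Longrightarrow>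
        (x i has_vector_derivative velocity (\<lambda>j. x j t) i) (at t)"
      "\<And>i t. i \<in> {1..n} \<Longrightarrow> 0 < t \<Longrightarrow> t < T \<Longrightarrow>
        (y i has_vector_derivative velocity (\<lambda>j. y j t) i) (at t)"
    and init: "\<And>i. i \<in> {1..n} \<Longrightarrow> x i 0 = y i 0"
    and i: "i \<in> {1..n}" and T: "0 \<le> T"
  shows "x i T = y i T"
proof -
  define K where "K = 2 * (2 * L + 3 * A)"
  have K: "0 \<le> K" using A_nonneg lipschitz_const_nonneg by (simp add: K_def)
  define d where "d i t = x i t - y i t" for i t
  define V where "V t = (\<Sum>i=1..n. d i t \<bullet> d i t)" for t
  let ?d' = "\<lambda>i t. velocity (\<lambda>j. x j t) i - velocity (\<lambda>j. y j t) i"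
  have "V T \<le> 0"
  proof (rule gronwall_nonpos[where M = "2 * K * real n" and w = V
        and w' = "\<lambda>t. \<Sum>i=1..n. 2 * (d i t \<bullet> ?d' i t)", OF T])
    show "continuous_on {0..T} V"
      unfolding V_def d_def by (intro continuous_intros cont)
    show "V 0 \<le> 0" using init by (simp add: V_def d_def)
    fix t :: real assume t: "0 < t" "t < T"
    show "(V has_real_derivative (\<Sum>i=1..n. 2 * (d i t \<bullet> ?d' i t))) (at t)"
      unfolding V_def
    proof (rule DERIV_sum)
      fix i assume i: "i \<in> {1..n}"
      have "(d i has_vector_derivative ?d' i t) (at t)"
        unfolding d_def by (intro has_vector_derivative_diff der i t)
      from inner_has_real_derivative[OF this this refl]
      show "((\<lambda>t. d i t \<bullet> d i t) has_real_derivative 2 * (d i t \<bullet> ?d' i t)) (at t)"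
        by (simp add: inner_commute)
    qed
    let ?S = "\<Sum>j\<in>{1..n}. norm (d j t)"
    have "(\<Sum>i=1..n. 2 * (d i t \<bullet> ?d' i t)) \<le> (\<Sum>i=1..n. 2 * (norm (d i t) * (K * ?S)))"
    proof (intro sum_mono mult_left_mono)
      fix i
      have "d i t \<bullet> ?d' i t \<le> norm (d i t) * norm (?d' i t)" by (rule norm_cauchy_schwarz)
      also have "\<dots> \<le> norm (d i t) * (K * ?S)"
        unfolding K_def d_def by (intro mult_left_mono velocity_lipschitz) auto
      finally show "d i t \<bullet> ?d' i t \<le> norm (d i t) * (K * ?S)" .
    qed auto
    also have "\<dots> = 2 * K * ?S\<^sup>2"
      by (simp add: sum_distrib_left[symmetric] sum_distrib_right[symmetric] power2_eq_square)
    also have "\<dots> \<le> 2 * K * (real n * V t)"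
      using sum_squared_le_sum_of_squares[of "\<lambda>i. norm (d i t)" "{1..n}"] K
      by (intro mult_left_mono) (auto simp: V_def power2_norm_eq_inner mult.commute)
    finally show "(\<Sum>i=1..n. 2 * (d i t \<bullet> ?d' i t)) \<le> 2 * K * real n * V t" by (simp add: mult_ac)
  qed
  moreover have "d i T \<bullet> d i T \<le> V T"
    unfolding V_def by (rule member_le_sum[OF i]) auto
  ultimately have "(norm (d i T))\<^sup>2 \<le> 0" unfolding power2_norm_eq_inner by linarith
  then show ?thesis by (simp add: d_def)
qed

section \<open>Dissipation and consensus\<close>

text \<open>
  The sum \<open>D\<close> of all \<open>1 - c\<^sub>i\<^sub>j\<close> decreases at least at the rate \<open>2 \<kappa> P\<close>, where \<open>P\<close> is the
  sum of all \<open>\<phi>(c\<^sub>i\<^sub>j) (1 - c\<^sub>i\<^sub>j)\<close>. If \<open>D\<close> stayed above \<open>\<epsilon>\<close>, then at each time some pair would have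
  \<open>1 - c\<^sub>i\<^sub>j \<ge> \<epsilon> / n\<^sup>2\<close>, which bounds \<open>P\<close> from below by a positive constant, and \<open>D\<close> would become negative in finite time.
\<close>

lemma solution_consensus:
  fixes x :: "nat \<Rightarrow> real \<Rightarrow> 'a::euclidean_space"
  assumes x: "solution x"
    and norms: "\<And>i t. i \<in> {1..n} \<Longrightarrow> 0 \<le> t \<Longrightarrow> norm (x i t) = 1"
    and \<kappa>: "0 < \<kappa>" "\<And>i j t. i \<in> {1..n} \<Longrightarrow> j \<in> {1..n} \<Longrightarrow> 0 \<le> t \<Longrightarrow> \<kappa> \<le> x i t \<bullet> x j t"
    and pos: "\<And>\<delta>. 0 < \<delta> \<Longrightarrow> \<exists>p>0. \<forall>c\<in>{\<kappa>..1 - \<delta>}. p \<le> \<phi> c"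
    and i: "i \<in> {1..n}" and j: "j \<in> {1..n}"
  shows "((\<lambda>t. x i t \<bullet> x j t) \<longlongrightarrow> 1) at_top"
proof -
  define c where "c i j t = x i t \<bullet> x j t" for i j t
  define D where "D t = (\<Sum>i=1..n. \<Sum>j=1..n. 1 - c i j t)" for t
  define P where "P t = (\<Sum>i=1..n. \<Sum>j=1..n. \<phi> (c i j t) * (1 - c i j t))" for t
  let ?F = "\<lambda>i s. velocity (\<lambda>j. x j s) i"
  have c_le: "c i j t \<le> 1" if "i \<in> {1..n}" "j \<in> {1..n}" "0 \<le> t" for i j t
    using sphere_inner_bounds[of "x i t" "x j t"] norms that by (auto simp: c_def)
  have D_ge: "1 - c i j t \<le> D t" if "i \<in> {1..n}" "j \<in> {1..n}" "0 \<le> t" for i j t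
  proof -
    have "1 - c i j t \<le> (\<Sum>j=1..n. 1 - c i j t)"
      using that by (intro member_le_sum) (auto simp: c_le)
    also have "\<dots> \<le> D t" unfolding D_def
      using that by (intro member_le_sum[of i _ "\<lambda>i. \<Sum>j=1..n. 1 - c i j t"]) (auto simp: c_le intro!: sum_nonneg)
    finally show ?thesis .
  qed
  have D_nonneg: "0 \<le> D t" if "0 \<le> t" for t
    using D_ge[OF i i that] c_le[OF i i that] by linarith
  have P_term: "0 \<le> \<phi> (c i j t) * (1 - c i j t)" if "i \<in> {1..n}" "j \<in> {1..n}" "0 \<le> t" for i j t
    using c_le[OF that] \<phi>_nonneg by simp
  have c_der: "(c i k has_real_derivative ?F i t \<bullet> x k t + x i t \<bullet> ?F k t) (at t)"
    if "i \<in> {1..n}" "k \<in> {1..n}" "0 < t" for i k t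
    unfolding c_def
    using inner_has_real_derivative[OF solutionD(2)[OF x that(1,3)] solutionD(2)[OF x that(2,3)] refl]
    by simp
  have D_der: "\<exists>D'. (D has_real_derivative D') (at t) \<and> D' \<le> - 2 * \<kappa> * P t" if t: "0 < t" for t
  proof -
    let ?a = "\<lambda>i j. \<phi> (c i j t)"
    define D' where "D' = (\<Sum>i=1..n. \<Sum>k=1..n. - (?F i t \<bullet> x k t + x i t \<bullet> ?F k t))"
    have "(D has_real_derivative D') (at t)"
      unfolding D_def D'_def
      by (intro DERIV_sum) (auto intro!: derivative_eq_intros c_der t)
    moreover have "D' \<le> - 2 * \<kappa> * P t"
    proof -
      have F: "?F i t \<bullet> x k t = (1 / real n) * (\<Sum>j=1..n. ?a i j * (c j k t - c i j t * c i k t))"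
        if "i \<in> {1..n}" for i k
      proof -
        have "?F i t = (1 / real n) *\<^sub>R (\<Sum>j=1..n. pull \<phi> (x i t) (x j t))"
          using norms t that by (intro velocity_on_sphere) auto
        then show ?thesis
          by (simp add: inner_sum_left pull_def inner_diff_left c_def)
      qed
      have "D' = - ((\<Sum>i=1..n. \<Sum>k=1..n. ?F i t \<bullet> x k t) + (\<Sum>i=1..n. \<Sum>k=1..n. ?F k t \<bullet> x i t))"
        unfolding D'_def sum_negf sum.distrib by (simp add: inner_commute)
      also have "(\<Sum>i=1..n. \<Sum>k=1..n. ?F k t \<bullet> x i t) = (\<Sum>i=1..n. \<Sum>k=1..n. ?F i t \<bullet> x k t)"
        by (rule sum.swap)
      also have "(\<Sum>i=1..n. \<Sum>k=1..n. ?F i t \<bullet> x k t)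
          = (\<Sum>i=1..n. \<Sum>k=1..n. (1 / real n) * (\<Sum>j=1..n. ?a i j * (c j k t - c i j t * c i k t)))"
        by (intro sum.cong refl F)
      also have "\<dots> = (1 / real n) * (\<Sum>i=1..n. \<Sum>k=1..n. \<Sum>j=1..n. ?a i j * (c j k t - c i j t * c i k t))"
        by (simp only: sum_distrib_left)
      also have "(\<Sum>i=1..n. \<Sum>k=1..n. \<Sum>j=1..n. ?a i j * (c j k t - c i j t * c i k t))
          = (\<Sum>i=1..n. \<Sum>j=1..n. \<Sum>k=1..n. ?a i j * (c j k t - c i j t * c i k t))"
        by (intro sum.cong refl sum.swap)
      finally have "D' = - (1 / real n) * (2 * (\<Sum>i=1..n. \<Sum>j=1..n. \<Sum>k=1..n. ?a i j * (c j k t - c i j t * c i k t)))"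
        by simp
      also have "\<dots> = - (1 / real n) * (\<Sum>i=1..n. \<Sum>j=1..n. \<Sum>k=1..n. ?a i j * (1 - c i j t) * (c i k t + c j k t))"
        by (subst sum_symmetrize) (auto simp: c_def inner_commute)
      also have "\<dots> \<le> - (1 / real n) * (\<Sum>i=1..n. \<Sum>j=1..n. \<Sum>k=1..n. ?a i j * (1 - c i j t) * (2 * \<kappa>))"
      proof (rule mult_left_mono_neg, intro sum_mono mult_left_mono)
        fix i j k assume ijk: "i \<in> {1..n}" "j \<in> {1..n}" "k \<in> {1..n}"
        show "2 * \<kappa> \<le> c i k t + c j k t"
          using \<kappa>(2)[of i k t] \<kappa>(2)[of j k t] ijk t by (simp add: c_def)
        show "0 \<le> ?a i j * (1 - c i j t)" using P_term ijk t by simp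
      qed auto
      also have "(\<Sum>i=1..n. \<Sum>j=1..n. \<Sum>k=1..n. ?a i j * (1 - c i j t) * (2 * \<kappa>)) = real n * (2 * \<kappa> * P t)"
        by (simp add: P_def sum_distrib_left mult_ac)
      also have "- (1 / real n) * \<dots> = - 2 * \<kappa> * P t" using n_pos by simp
      finally show ?thesis .
    qed
    ultimately show ?thesis by blast
  qed
  have P_nonneg: "0 \<le> P t" if "0 \<le> t" for t
    unfolding P_def using P_term that by (intro sum_nonneg) auto
  have D_cont: "continuous_on {a..b} D" if "0 \<le> a" for a b
  proof -
    have "continuous_on {0..b} D"
      unfolding D_def c_def by (intro continuous_intros solutionD(3)[OF x])
    then show ?thesis by (rule continuous_on_subset) (use that in auto)
  qed
  have D_antimono: "D b \<le> D a" if "0 \<le> a" "a \<le> b" for a b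
  proof (rule DERIV_nonpos_imp_decreasing_open[OF \<open>a \<le> b\<close> _ D_cont[OF \<open>0 \<le> a\<close>]])
    fix t assume "a < t" "t < b"
    then have t: "0 < t" using \<open>0 \<le> a\<close> by simp
    obtain D' where "(D has_real_derivative D') (at t)" "D' \<le> - 2 * \<kappa> * P t"
      using D_der[OF t] by blast
    moreover have "- 2 * \<kappa> * P t \<le> 0"
      using \<kappa>(1) P_nonneg[of t] t by simp
    ultimately show "\<exists>y. (D has_real_derivative y) (at t) \<and> y \<le> 0" by (meson order_trans)
  qed
  have D_small: "\<exists>t\<ge>0. D t < \<epsilon>" if \<epsilon>: "0 < \<epsilon>" for \<epsilon>
  proof (rule ccontr)
    assume "\<not> (\<exists>t\<ge>0. D t < \<epsilon>)"
    then have large: "\<epsilon> \<le> D t" if "0 \<le> t" for t using that by force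
    define \<delta> where "\<delta> = \<epsilon> / (real n)\<^sup>2"
    have \<delta>: "0 < \<delta>" using \<epsilon> n_pos by (simp add: \<delta>_def)
    obtain p where p: "p > 0" "\<And>c. c \<in> {\<kappa>..1 - \<delta>} \<Longrightarrow> p \<le> \<phi> c" using pos[OF \<delta>] by blast
    have P_large: "p * \<delta> \<le> P t" if t: "0 \<le> t" for t
    proof -
      have "\<exists>i\<in>{1..n}. \<exists>j\<in>{1..n}. \<delta> \<le> 1 - c i j t"
      proof (rule ccontr)
        assume "\<not> ?thesis"
        then have "1 - c i j t < \<delta>" if "i \<in> {1..n}" "j \<in> {1..n}" for i j
          using that by (meson not_le)
        then have "D t < (\<Sum>i=1..n. \<Sum>j=1..n. \<delta>)"
          unfolding D_def using n_pos by (intro sum_strict_mono) auto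
        also have "\<dots> = \<epsilon>" using n_pos by (simp add: \<delta>_def power2_eq_square)
        finally show False using large[OF t] by simp
      qed
      then obtain k l where kl: "k \<in> {1..n}" "l \<in> {1..n}" and "\<delta> \<le> 1 - c k l t" by blast
      moreover have "\<kappa> \<le> c k l t" unfolding c_def by (rule \<kappa>(2)[OF kl t])
      ultimately have "p * \<delta> \<le> \<phi> (c k l t) * (1 - c k l t)"
        using p \<delta> \<phi>_nonneg by (intro mult_mono) auto
      also have "\<dots> \<le> (\<Sum>j=1..n. \<phi> (c k j t) * (1 - c k j t))"
        using kl t P_term by (intro member_le_sum) auto
      also have "\<dots> \<le> P t" unfolding P_def
        using kl t P_term
        by (intro member_le_sum[of k _ "\<lambda>i. \<Sum>j=1..n. \<phi> (c i j t) * (1 - c i j t)"]) (auto intro!: sum_nonneg)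
      finally show ?thesis .
    qed
    define q where "q = 2 * \<kappa> * (p * \<delta>)"
    have q: "q > 0" using \<kappa> p \<delta> by (simp add: q_def)
    define T where "T = (D 0 + 1) / q"
    have T: "0 \<le> T" using q D_nonneg[of 0] by (simp add: T_def)
    have "D T + q * T \<le> D 0 + q * 0"
    proof (rule DERIV_nonpos_imp_decreasing_open[OF T])
      fix t assume t: "0 < t" "t < T"
      obtain D' where D': "(D has_real_derivative D') (at t)" "D' \<le> - 2 * \<kappa> * P t"
        using D_der[OF t(1)] by blast
      have "((\<lambda>t. D t + q * t) has_real_derivative D' + q) (at t)"
        by (auto intro!: derivative_eq_intros D')
      moreover have "q \<le> 2 * \<kappa> * P t"
        unfolding q_def using P_large[of t] t \<kappa> by (intro mult_left_mono) auto
      then have "D' + q \<le> 0" using D'(2) by simp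
      ultimately show "\<exists>y. ((\<lambda>t. D t + q * t) has_real_derivative y) (at t) \<and> y \<le> 0" by blast
    qed (intro continuous_intros D_cont order_refl)
    moreover have "q * T = D 0 + 1" using q by (simp add: T_def)
    ultimately show False using D_nonneg[OF T] by simp
  qed
  have "(D \<longlongrightarrow> 0) at_top"
  proof (rule tendstoI)
    fix \<epsilon> :: real assume "0 < \<epsilon>"
    then obtain t0 where t0: "t0 \<ge> 0" "D t0 < \<epsilon>" using D_small by blast
    show "\<forall>\<^sub>F t in at_top. dist (D t) 0 < \<epsilon>"
      using eventually_ge_at_top[of t0]
    proof eventually_elim
      case (elim t)
      then show ?case using D_antimono[of t0 t] D_nonneg[of t] t0 by simp
    qed
  qed
  then have "((\<lambda>t. 1 - D t) \<longlongrightarrow> 1) at_top" by (auto intro!: tendsto_eq_intros)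
  moreover have "\<forall>\<^sub>F t in at_top. 1 - D t \<le> c i j t"
    using eventually_ge_at_top[of 0] by eventually_elim (use D_ge[OF i j] in force)
  moreover have "\<forall>\<^sub>F t in at_top. c i j t \<le> 1"
    using eventually_ge_at_top[of 0] by eventually_elim (rule c_le[OF i j])
  ultimately have "((\<lambda>t. c i j t) \<longlongrightarrow> 1) at_top"
    using tendsto_sandwich[of "\<lambda>t. 1 - D t" "c i j" at_top "\<lambda>_. 1" 1] by simp
  then show ?thesis by (simp add: c_def)
qed

end

section \<open>Spherical caps and convergence in them\<close>

text \<open>
  This is the triangle inequality for spherical distances, in the form that points within distance
  \<open>r\<close> of \<open>e\<close> are within \<open>2 r\<close> of each other: the components along \<open>e\<close> contribute at least
  \<open>cos\<^sup>2 r\<close>, those orthogonal to \<open>e\<close> at least \<open>- sin\<^sup>2 r\<close>.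
\<close>

lemma inner_ge_cos_double:
  fixes p q e :: "'a::real_inner"
  assumes unit: "norm p = 1" "norm q = 1" "norm e = 1"
    and r: "0 \<le> r" "r \<le> pi / 2" and p: "cos r \<le> p \<bullet> e" and q: "cos r \<le> q \<bullet> e"
  shows "cos (2 * r) \<le> p \<bullet> q"
proof -
  define a where "a = p - (p \<bullet> e) *\<^sub>R e"
  define b where "b = q - (q \<bullet> e) *\<^sub>R e"
  have sq: "p \<bullet> p = 1" "q \<bullet> q = 1" "e \<bullet> e = 1" using unit by (simp_all add: norm_eq_1)
  have c0: "0 \<le> cos r" using r by (intro cos_ge_zero) auto
  have s0: "0 \<le> sin r" using r pi_ge_zero by (intro sin_ge_zero) linarith+
  have "(norm a)\<^sup>2 = 1 - (p \<bullet> e)\<^sup>2" "(norm b)\<^sup>2 = 1 - (q \<bullet> e)\<^sup>2"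
    unfolding a_def b_def power2_norm_eq_inner
    using sq by (simp_all add: inner_diff_left inner_diff_right
      inner_commute[of e p] inner_commute[of e q] power2_eq_square)
  moreover have "(cos r)\<^sup>2 \<le> (p \<bullet> e)\<^sup>2" "(cos r)\<^sup>2 \<le> (q \<bullet> e)\<^sup>2"
    using p q c0 by (auto intro: power_mono)
  ultimately have "(norm a)\<^sup>2 \<le> (sin r)\<^sup>2" "(norm b)\<^sup>2 \<le> (sin r)\<^sup>2"
    by (auto simp: sin_squared_eq)
  then have "norm a \<le> sin r" "norm b \<le> sin r" using s0 by (auto intro: power2_le_imp_le)
  then have "norm a * norm b \<le> sin r * sin r" using s0 by (intro mult_mono) auto
  moreover have "\<bar>a \<bullet> b\<bar> \<le> norm a * norm b" by (rule Cauchy_Schwarz_ineq2)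
  ultimately have "- (sin r)\<^sup>2 \<le> a \<bullet> b" by (simp add: power2_eq_square abs_le_iff)
  moreover have "a \<bullet> b = p \<bullet> q - (p \<bullet> e) * (q \<bullet> e)"
    using sq by (simp add: a_def b_def inner_diff_left inner_diff_right inner_commute[of e p] inner_commute[of e q])
  moreover have "cos r * cos r \<le> (p \<bullet> e) * (q \<bullet> e)" using p q c0 by (intro mult_mono) auto
  ultimately show ?thesis by (simp add: cos_double power2_eq_square)
qed

lemma norm_north_pole: "norm (north_pole :: 'k::finite ambient) = 1"
  by (simp add: north_pole_def norm_Pair)

lemma closed_cap_iff:
  assumes "0 \<le> r" "r \<le> pi"
  shows "x \<in> closed_cap r \<longleftrightarrow> norm x = 1 \<and> cos r \<le> x \<bullet> north_pole"
proof (cases "norm x = 1")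
  case True
  then have b: "-1 \<le> x \<bullet> north_pole" "x \<bullet> north_pole \<le> 1"
    using sphere_inner_bounds[OF True norm_north_pole] by auto
  have "arccos (x \<bullet> north_pole) \<le> r \<longleftrightarrow> cos r \<le> x \<bullet> north_pole"
    using arccos_le_arccos[of "cos r" "x \<bullet> north_pole"] cos_monotone_0_pi_le[of "arccos (x \<bullet> north_pole)" r]
      assms b arccos_lbound[OF b] arccos_ubound[OF b] by (auto simp: arccos_cos)
  then show ?thesis using True by (simp add: closed_cap_def sphere_dist_def)
qed (simp add: closed_cap_def)

theorem theorem4p14:
  fixes n :: nat and r \<epsilon> C \<alpha> :: real
    and K :: "'k::finite ambient \<Rightarrow> 'k ambient \<Rightarrow> real"
    and g g' g'' :: "real \<Rightarrow> real"
    and x0 :: "nat \<Rightarrow> 'k ambient"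
  assumes "n \<ge> 2"
    and "0 < \<epsilon>" and "\<epsilon> < pi / 2"
    and "0 < r" and "r < pi / 4 - \<epsilon>"
    and "\<And>x y. x \<in> sphere 0 1 \<Longrightarrow> y \<in> sphere 0 1 \<Longrightarrow> K x y = g ((sphere_dist x y)\<^sup>2)"
    and "\<And>s. s \<ge> 0 \<Longrightarrow> (g has_real_derivative g' s) (at s within {0..})"
    and "local_lipschitz (UNIV :: real set) {0..} (\<lambda>_. g')"
    and "\<And>s. s \<ge> 0 \<Longrightarrow> g' s \<ge> 0"
    and "\<And>s. s \<in> {0..4 * r\<^sup>2} \<Longrightarrow> (g' has_real_derivative g'' s) (at s within {0..4 * r\<^sup>2})"
    and "continuous_on {0..4 * r\<^sup>2} g''"
    and "C > 0" and "\<alpha> \<ge> 0"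
    and "\<And>s. s \<in> {0..4 * r\<^sup>2} \<Longrightarrow> g' s \<ge> C * rpow s \<alpha>"
    and "\<And>i. i \<in> {1..n} \<Longrightarrow> x0 i \<in> closed_cap r"
  shows "\<exists>x. gradient_flow_solution n K x0 x
           \<and> (\<forall>y. gradient_flow_solution n K x0 y \<longrightarrow> (\<forall>i\<in>{1..n}. \<forall>t\<ge>0. y i t = x i t))
           \<and> (\<forall>i\<in>{1..n}. \<forall>t\<ge>0. x i t \<in> closed_cap r)
           \<and> (\<forall>i\<in>{1..n}. \<forall>j\<in>{1..n}. ((\<lambda>t. sphere_dist (x i t) (x j t)) \<longlongrightarrow> 0) at_top)"
proof -
  note K = assms(6) and g = assms(7) and g'_nonneg = assms(9)
  have r: "0 < r" "r < pi / 4" using assms(2,4,5) by auto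
  then have r': "0 \<le> r" "r \<le> pi / 2" "r \<le> pi" using pi_gt_zero by linarith+
  have cos2r: "0 < cos (2 * r)" using r by (intro cos_gt_zero_pi) auto
  have cosr: "0 \<le> cos r" using r' by (intro cos_ge_zero) auto
  obtain L where L: "L-lipschitz_on {0..1} (attraction g')"
    using attraction_lipschitz[OF assms(8)] by blast
  \<comment> \<open>In the cap all cosines exceed the positive number \<open>cos (2 * r)\<close>, so clamping changes nothing there.\<close>
  define \<phi> where "\<phi> c = attraction g' (max 0 (min 1 c))" for c
  define A where "A = attraction g' 1 + L"
  interpret sphere_flow n \<phi> A L
  proof
    show "0 < n" using assms(1) by simp
    fix c d :: real
    show "0 \<le> \<phi> c" unfolding \<phi>_def by (intro attraction_nonneg g'_nonneg) auto
    have "\<bar>\<phi> c - \<phi> d\<bar> \<le> L * \<bar>max 0 (min 1 c) - max 0 (min 1 d)\<bar>"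
      unfolding \<phi>_def using lipschitz_onD[OF L, of "max 0 (min 1 c)" "max 0 (min 1 d)"]
      by (simp add: dist_real_def)
    also have "\<dots> \<le> L * \<bar>c - d\<bar>"
      by (intro mult_left_mono lipschitz_on_nonneg[OF L]) (auto simp: max_def min_def)
    finally show "\<bar>\<phi> c - \<phi> d\<bar> \<le> L * \<bar>c - d\<bar>" .
    have "\<bar>\<phi> c - attraction g' 1\<bar> \<le> L * \<bar>max 0 (min 1 c) - 1\<bar>"
      unfolding \<phi>_def using lipschitz_onD[OF L, of "max 0 (min 1 c)" 1]
      by (simp add: dist_real_def)
    also have "\<dots> \<le> L * 1"
      by (intro mult_left_mono lipschitz_on_nonneg[OF L]) (auto simp: max_def min_def)
    finally show "\<phi> c \<le> A" by (simp add: A_def)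
  qed
  have velocity_eq: "velocity u i
      = - (1 / real n) *\<^sub>R (\<Sum>j=1..n. sphere_gradient (\<lambda>z. K z (u j)) (u i))"
    if norms: "\<And>j. j \<in> {1..n} \<Longrightarrow> norm (u j) = 1" and i: "i \<in> {1..n}"
      and pos: "\<And>j. j \<in> {1..n} \<Longrightarrow> 0 < u i \<bullet> u j" for u :: "nat \<Rightarrow> 'k ambient" and i
  proof -
    have "pull \<phi> (u i) (u j) = - sphere_gradient (\<lambda>z. K z (u j)) (u i)" if j: "j \<in> {1..n}" for j
    proof -
      have "u i \<bullet> u j \<le> 1" using sphere_inner_bounds[of "u i" "u j"] norms i j by auto
      then have "\<phi> (u i \<bullet> u j) = attraction g' (u i \<bullet> u j)"
        using pos[OF j] by (simp add: \<phi>_def max_def min_def)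
      then show ?thesis
        using sphere_gradient_radial_kernel[of "u i" "u j" "\<lambda>z. K z (u j)" g g'] norms i j pos[OF j] K g
        by (simp add: pull_def)
    qed
    then have "(\<Sum>j=1..n. pull \<phi> (u i) (u j)) = (\<Sum>j=1..n. - sphere_gradient (\<lambda>z. K z (u j)) (u i))"
      by (rule sum.cong[OF refl])
    then show ?thesis using velocity_on_sphere[OF norms i] by (simp add: sum_negf)
  qed
  obtain x :: "nat \<Rightarrow> real \<Rightarrow> 'k ambient" where x: "solution x" and x_init: "\<And>i. x i 0 = x0 i"
    using solution_exists[of x0] by blast
  have x0: "norm (x0 i) = 1" "cos r \<le> x0 i \<bullet> north_pole" if "i \<in> {1..n}" for i
    using assms(15)[OF that] closed_cap_iff[OF r'(1,3), of "x0 i"] by blast+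
  have x_norm: "norm (x i t) = 1" if "i \<in> {1..n}" "0 \<le> t" for i t
    using solution_norm_eq_1[OF x] x0 x_init that by metis
  have x_height: "cos r \<le> x i t \<bullet> north_pole" if "i \<in> {1..n}" "0 \<le> t" for i t
    by (rule solution_height_bound[OF x _ cosr _ that]) (simp_all add: x_init x0)
  have x_pair: "cos (2 * r) \<le> x i t \<bullet> x j t" if "i \<in> {1..n}" "j \<in> {1..n}" "0 \<le> t" for i j t
    using that by (intro inner_ge_cos_double[OF _ _ norm_north_pole r'(1,2)] x_norm x_height)
  have "gradient_flow_solution n K x0 x"
    unfolding gradient_flow_solution_def
  proof (intro ballI conjI allI impI)
    fix i and t :: real assume i: "i \<in> {1..n}" and t: "0 \<le> t"
    show "x i t \<in> sphere 0 1" using x_norm[OF i t] by simp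
    have "velocity (\<lambda>j. x j t) i
        = - (1 / real n) *\<^sub>R (\<Sum>j=1..n. sphere_gradient (\<lambda>z. K z (x j t)) (x i t))"
      using x_norm t x_pair cos2r i by (intro velocity_eq) (auto intro: less_le_trans)
    then show "(x i has_vector_derivative
        - (1 / real n) *\<^sub>R (\<Sum>j=1..n. sphere_gradient (\<lambda>z. K z (x j t)) (x i t))) (at t within {0..})"
      using solutionD(1)[OF x i t] by simp
  qed (rule x_init)
  moreover have "y i t = x i t"
    if y: "gradient_flow_solution n K x0 y" and it: "i \<in> {1..n}" "0 \<le> t" for y i t
  proof -
    have y_init: "y i 0 = x0 i" if "i \<in> {1..n}" for i
      using y that by (simp add: gradient_flow_solution_def)
    have y_norm: "norm (y i t) = 1" if "i \<in> {1..n}" "0 \<le> t" for i t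
      using y that by (auto simp: gradient_flow_solution_def)
    have y_der: "(y i has_vector_derivative
          - (1 / real n) *\<^sub>R (\<Sum>j=1..n. sphere_gradient (\<lambda>z. K z (y j t)) (y i t))) (at t within {0..})"
      if "i \<in> {1..n}" "0 \<le> t" for i t
      using y that by (simp add: gradient_flow_solution_def)
    have y_cont: "continuous_on {0..} (y i)" if "i \<in> {1..n}" for i
      using y_der[OF that] by (meson atLeast_iff continuous_on_eq_continuous_within has_vector_derivative_continuous)
    have agree: "y i T = x i T"
      if T: "0 \<le> T" and pos: "\<And>i j t. i \<in> {1..n} \<Longrightarrow> j \<in> {1..n} \<Longrightarrow> 0 < t \<Longrightarrow> t < T \<Longrightarrow> 0 < y i t \<bullet> y j t"
        and i: "i \<in> {1..n}" for T i
    proof (rule solutions_agree[OF _ _ _ _ _ i T])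
      fix i t assume i: "i \<in> {1..n}" and t: "0 < t" "t < T"
      show "(x i has_vector_derivative velocity (\<lambda>j. x j t) i) (at t)" by (rule solutionD(2)[OF x i t(1)])
      have "velocity (\<lambda>j. y j t) i
          = - (1 / real n) *\<^sub>R (\<Sum>j=1..n. sphere_gradient (\<lambda>z. K z (y j t)) (y i t))"
        using y_norm pos i t by (intro velocity_eq) auto
      then show "(y i has_vector_derivative velocity (\<lambda>j. y j t) i) (at t)"
        using y_der[OF i, of t] t
        by (simp add: at_within_interior[of t "{0..}"] interior_Ici[of "-1"])
    next
      fix i assume i: "i \<in> {1..n}"
      show "continuous_on {0..T} (y i)" using y_cont[OF i] by (rule continuous_on_subset) auto
      show "continuous_on {0..T} (x i)" by (rule solutionD(3)[OF x i])
      show "y i 0 = x i 0" using y_init[OF i] x_init by simp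
    qed
    have y_pair: "0 < y i t \<bullet> y j t" if "i \<in> {1..n}" "j \<in> {1..n}" "0 \<le> t" for i j t
    proof (rule ccontr)
      assume neg: "\<not> 0 < y i t \<bullet> y j t"
      \<comment> \<open>The first time at which some pair is at angle at least \<open>pi / 2\<close> leads to a contradiction.\<close>
      define S where "S = (\<Union>i\<in>{1..n}. \<Union>j\<in>{1..n}. {t \<in> {0..}. y i t \<bullet> y j t \<le> 0})"
      have "t \<in> S" unfolding S_def by (intro UN_I[of i] UN_I[of j]) (use neg that in auto)
      have "closed S"
        unfolding S_def
        by (intro closed_UN ballI finite_atLeastAtMost continuous_on_closed_Collect_le continuous_intros y_cont closed_atLeast) auto
      moreover have bdd: "bdd_below S" by (rule bdd_belowI[of _ 0]) (auto simp: S_def)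
      ultimately have "Inf S \<in> S" using \<open>t \<in> S\<close> by (intro closed_contains_Inf) auto
      then obtain k l where kl: "k \<in> {1..n}" "l \<in> {1..n}" "0 \<le> Inf S" "y k (Inf S) \<bullet> y l (Inf S) \<le> 0"
        by (auto simp: S_def)
      have "0 < y i t \<bullet> y j t" if "i \<in> {1..n}" "j \<in> {1..n}" "0 < t" "t < Inf S" for i j t
      proof (rule ccontr)
        assume "\<not> 0 < y i t \<bullet> y j t"
        then have "t \<in> S" unfolding S_def by (intro UN_I[of i] UN_I[of j]) (use that in auto)
        then show False using cInf_lower[OF _ bdd] that(4) by force
      qed
      then have "y k (Inf S) = x k (Inf S)" "y l (Inf S) = x l (Inf S)"
        using agree[OF kl(3)] kl(1,2) by blast+
      then show False using kl(4) x_pair[OF kl(1,2,3)] cos2r by simp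
    qed
    show ?thesis by (rule agree[OF it(2) _ it(1)]) (simp add: y_pair)
  qed
  moreover have "x i t \<in> closed_cap r" if "i \<in> {1..n}" "0 \<le> t" for i t
    using closed_cap_iff[OF r'(1,3)] x_norm x_height that by blast
  moreover have "((\<lambda>t. sphere_dist (x i t) (x j t)) \<longlongrightarrow> 0) at_top"
    if ij: "i \<in> {1..n}" "j \<in> {1..n}" for i j
  proof -
    have "((\<lambda>t. x i t \<bullet> x j t) \<longlongrightarrow> 1) at_top"
    proof (rule solution_consensus[OF x x_norm cos2r x_pair _ ij])
      fix \<delta> :: real assume \<delta>: "0 < \<delta>"
      obtain p where p: "p > 0" "\<And>c. c \<in> {cos (2 * r)..1 - \<delta>} \<Longrightarrow> p \<le> attraction g' c"
        using attraction_bounded_below[OF r assms(12,13,14) \<delta>] by blast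
      have "p \<le> \<phi> c" if "c \<in> {cos (2 * r)..1 - \<delta>}" for c
        using p(2)[OF that] that cos2r \<delta> by (simp add: \<phi>_def max_def min_def)
      then show "\<exists>p>0. \<forall>c\<in>{cos (2 * r)..1 - \<delta>}. p \<le> \<phi> c" using p(1) by blast
    qed
    moreover have "\<forall>\<^sub>F t in at_top. x i t \<bullet> x j t \<in> {-1..1}"
      using eventually_ge_at_top[of 0]
      by eventually_elim (intro sphere_inner_bounds x_norm ij)
    ultimately have "((\<lambda>t. arccos (x i t \<bullet> x j t)) \<longlongrightarrow> arccos 1) at_top"
      by (intro continuous_on_tendsto_compose[OF continuous_on_arccos']) auto
    then show ?thesis by (simp add: sphere_dist_def)
  qed
  ultimately show ?thesis by blast
qed

end
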